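(* Let $\{S_n\}_{n\ge0}$ be the right random walk $S_n=X_1\cdots X_n$ ($S_0=e$ the identity) on a Cayley graph $(G,\mathcal S)$ of an infinite group $G$ generated by a finite set $\mathcal S=\{g_1,\dots,g_s,g_1^{-1},\dots,g_s^{-1}\}$, where the step weights satisfy $\alpha_i=\alpha_{s+i}$ for $1\le i\le s$ and $\alpha_i>0$ for all $i$. Assume that at least one of the following two conditions holds: (A) $\displaystyle\limsup_{n\to\infty}\frac{u_{2n}}{u_{4n}}<\infty$; (B) there exist two functions $g,h\ge0$ on $\mathbb Z_+$ such that $g(n)$ is nondecreasing and tends to $\infty$, $\lim_{n\to\infty}\frac1n g(n)=0$, $$\lim_{n\to\infty,\ n\text{ even}} n\,h\Big(\Big\lfloor\frac{n}{g(n/2)}\Big\rfloor\Big)=0,$$ and, for all large $n$, $e^{-g(n)}\le u_{2n}\le h(n)$. Then for all $\varepsilon>0$ $$\lim_{n\to\infty,\;p\mid n}P\Big\{\Big|\tfrac1nR_n-1+F\Big|>\varepsilon\,\Big|\,\mathcal E_n\Big\}=0 .$$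
   Context: Cayley graph $(G,\mathcal S)$: vertices are the elements of $G$, with an edge between $v'$ and $v''$ iff $v''=v'g_i$ or $v''=v'g_i^{-1}$ for some $1\le i\le s$. Random walk on $(G,\mathcal S)$: given $\alpha_i\ge0$, $1\le i\le 2s$, with $\sum_{i=1}^{2s}\alpha_i=1$, let $X,X_1,X_2,\dots$ be i.i.d. $G$-valued with law giving weight $\alpha_i$ to $g_i$ and $\alpha_{s+i}$ to $g_i^{-1}$ ($1\le i\le s$; weights of coinciding elements are added), and $S_n=X_1\cdots X_n$. Notation: $\mathcal E_n=\{S_n=e\}$; $u_n=P\{\mathcal E_n\}$; $f_n=P\{S_k\ne e \text{ for } 1\le k\le n-1,\ S_n=e\}$ for $n\ge1$; $F=\sum_{n=1}^\infty f_n$ (the probability of ever returning to $e$); $R_n=|\{S_0,S_1,\dots,S_{n-1}\}|$ (the range). The period is $p=\gcd\{n\ge1:u_n>0\}$, which is $1$ or $2$. The notation $\lim_{n\to\infty,\,p\mid n}$ means the limit along multiples $n$ of $p$ (for which $u_n>0$ once $n$ is large). $\mathbb Z_+=\{0,1,2,\dots\}$. *)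

theory Defs
  imports "HOL-Probability.Probability" "HOL-Algebra.Generated_Groups"
begin

text \<open>
  The step law is the sum of the point masses attached to the \<open>2 * s\<close> listed generators, so that
  the weights of coinciding elements (\<open>gen i = gen j\<close>, \<open>gen i = inv (gen j)\<close>, ...) are added.
  The list \<open>gen 1, ..., gen s\<close> may contain repetitions and the identity.
\<close>

definition step_weight ::
  "('a, 'b) monoid_scheme \<Rightarrow> nat \<Rightarrow> (nat \<Rightarrow> 'a) \<Rightarrow> (nat \<Rightarrow> real) \<Rightarrow> 'a \<Rightarrow> real" where
  "step_weight G s gen \<alpha> x =
     (\<Sum>i\<in>{i\<in>{1..s}. gen i = x}. \<alpha> i) + (\<Sum>i\<in>{i\<in>{1..s}. inv\<^bsub>G\<^esub> (gen i) = x}. \<alpha> (s + i))"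

text \<open>
  The steps are \<open>X 1, X 2, ...\<close>; the value \<open>X 0\<close> plays no role.
  Independence with respect to the discrete \<open>\<sigma>\<close>-algebra on \<open>carrier G\<close> includes that each \<open>X n\<close> is
  a \<open>carrier G\<close>-valued random variable.
\<close>

locale cayley_random_walk = group G + prob_space M
  for G :: "('a, 'b) monoid_scheme" (structure) and M :: "'w measure" +
  fixes s :: nat and gen :: "nat \<Rightarrow> 'a" and \<alpha> :: "nat \<Rightarrow> real" and X :: "nat \<Rightarrow> 'w \<Rightarrow> 'a"
  assumes gen_closed: "\<And>i. i \<in> {1..s} \<Longrightarrow> gen i \<in> carrier G"
    and gen_generates: "generate G (gen ` {1..s} \<union> (\<lambda>i. inv (gen i)) ` {1..s}) = carrier G"
    and weight_nonneg: "\<And>i. i \<in> {1..2 * s} \<Longrightarrow> 0 \<le> \<alpha> i"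
    and weight_sum: "(\<Sum>i = 1..2 * s. \<alpha> i) = 1"
    and steps_indep: "indep_vars (\<lambda>_. count_space (carrier G)) X {1..}"
    and steps_law: "\<And>n x. 1 \<le> n \<Longrightarrow> x \<in> carrier G \<Longrightarrow>
      \<P>(\<omega> in M. X n \<omega> = x) = step_weight G s gen \<alpha> x"

primrec walk :: "('a, 'b) monoid_scheme \<Rightarrow> (nat \<Rightarrow> 'w \<Rightarrow> 'a) \<Rightarrow> nat \<Rightarrow> 'w \<Rightarrow> 'a" where
  "walk G X 0 \<omega> = \<one>\<^bsub>G\<^esub>"
| "walk G X (Suc n) \<omega> = walk G X n \<omega> \<otimes>\<^bsub>G\<^esub> X (Suc n) \<omega>"

definition return_prob ::
  "('a, 'b) monoid_scheme \<Rightarrow> 'w measure \<Rightarrow> (nat \<Rightarrow> 'w \<Rightarrow> 'a) \<Rightarrow> nat \<Rightarrow> real" where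
  "return_prob G M X n = \<P>(\<omega> in M. walk G X n \<omega> = \<one>\<^bsub>G\<^esub>)"

definition first_return_prob ::
  "('a, 'b) monoid_scheme \<Rightarrow> 'w measure \<Rightarrow> (nat \<Rightarrow> 'w \<Rightarrow> 'a) \<Rightarrow> nat \<Rightarrow> real" where
  "first_return_prob G M X n =
     \<P>(\<omega> in M. (\<forall>k. 1 \<le> k \<and> k \<le> n - 1 \<longrightarrow> walk G X k \<omega> \<noteq> \<one>\<^bsub>G\<^esub>) \<and> walk G X n \<omega> = \<one>\<^bsub>G\<^esub>)"

text \<open>The sum ranges over \<open>n \<ge> 1\<close>, hence the index shift.\<close>

definition ever_return_prob ::
  "('a, 'b) monoid_scheme \<Rightarrow> 'w measure \<Rightarrow> (nat \<Rightarrow> 'w \<Rightarrow> 'a) \<Rightarrow> real" where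
  "ever_return_prob G M X = (\<Sum>n. first_return_prob G M X (Suc n))"

definition walk_range ::
  "('a, 'b) monoid_scheme \<Rightarrow> (nat \<Rightarrow> 'w \<Rightarrow> 'a) \<Rightarrow> nat \<Rightarrow> 'w \<Rightarrow> nat" where
  "walk_range G X n \<omega> = card ((\<lambda>k. walk G X k \<omega>) ` {..<n})"

definition walk_period ::
  "('a, 'b) monoid_scheme \<Rightarrow> 'w measure \<Rightarrow> (nat \<Rightarrow> 'w \<Rightarrow> 'a) \<Rightarrow> nat" where
  "walk_period G M X = Gcd {n. 1 \<le> n \<and> 0 < return_prob G M X n}"

text \<open>The filter \<open>n \<rightarrow> \<infinity>\<close> along the multiples of \<open>p\<close> (a proper filter iff \<open>p > 0\<close>).\<close>

definition multiples_at_top :: "nat \<Rightarrow> nat filter" where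
  "multiples_at_top p = inf sequentially (principal {n. p dvd n})"

end

theory Submission
  imports Defs
begin

text \<open>
  The range \<open>R\<close> at time \<open>n\<close> is the number of times \<open>k < n\<close> at which the walk is at a point for the last
  time before \<open>n\<close>. Call \<open>k\<close> fresh if the walk does not come back to its position at time \<open>k\<close> during the
  next \<open>N\<close> steps, and let \<open>V\<close> be the number of fresh times. Last visits are fresh, except possibly for the
  last \<open>N\<close> times, and a fresh time that is not a last visit starts a loop longer than \<open>N\<close>, so
  \<open>V - (number of long loops) \<le> R \<le> V + N\<close> (lemmas \<open>card_range_le_fresh\<close> and \<open>fresh_le_card_range\<close>).

  Freshness depends on \<open>N\<close> consecutive steps only. Along a residue class modulo \<open>N\<close> the fresh indicators
  are therefore independent, and Hoeffding's inequality makes deviations of \<open>V / n\<close> from its mean, which tends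
  to \<open>1 - F\<close> as \<open>N\<close> grows, exponentially unlikely (\<open>fresh_concentration\<close>). Either one of the conditions
  (A) and (B) implies that the return probabilities \<open>u\<close> decay more slowly than any exponential, so this survives
  the division by \<open>u n\<close>. This settles the upper bound, and it settles everything if \<open>F = 1\<close>.

  If \<open>F < 1\<close>, then \<open>u\<close> is summable by renewal, and it remains to see that a bridge has few long loops.
  Cutting out a loop of length \<open>j\<close> leaves a bridge of length \<open>n - j\<close>, so the expected number of long
  loops in a bridge is the sum of \<open>(n - j) * u j * u (n - j) / u n\<close> over \<open>N < j < n\<close>. For large
  \<open>N\<close> it is at most a small multiple of \<open>n\<close>, by the log-convexity of the even return probabilities \<open>w k = u (2 * k)\<close>, a consequence of symmetry and the
  Cauchy--Schwarz inequality. Suppose that \<open>w (a - m a - 1)\<close> is bounded by a multiple of \<open>w a\<close>.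
  For \<open>j div 2 \<le> m a\<close>, where \<open>a = n div 2\<close>, the quotient \<open>u (n - j) / u n\<close> is then bounded and the
  tail of \<open>u\<close> is small. For \<open>(n - j) div 2 \<le> m a\<close> the roles are exchanged, and the small factor
  is \<open>(n - j) / n\<close>, the fraction of possible starting times.
  In between, log-convexity bounds \<open>u j * u (n - j)\<close> by a multiple of \<open>w (m a) * w a\<close>
  (\<open>long_loops_negligible\<close>).
  Condition (A) allows \<open>m a = a div 2\<close>, which leaves nothing in between. Condition (B) allows
  \<open>m a = \<lfloor>2 * a / g a\<rfloor>\<close>, because log-convexity turns \<open>exp (- g a) \<le> w a\<close> into
  \<open>w (a - i) \<le> exp (i * g a / a) * w a\<close>, and the upper bound \<open>h\<close> makes \<open>a * w (m a)\<close> tend to \<open>0\<close>.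
\<close>

section \<open>Convex sequences\<close>

lemma convex_seq_increment_mono:
  fixes l :: "nat \<Rightarrow> real"
  assumes convex: "\<And>k. 2 * l (Suc k) \<le> l k + l (Suc (Suc k))" and "m \<le> c"
  shows "l (m + t) - l m \<le> l (c + t) - l c"
proof (induction t)
  case (Suc t)
  have "l (Suc k) - l k \<le> l (Suc (Suc k)) - l (Suc k)" for k
    using convex[of k] by simp
  then have "l (Suc (m + t)) - l (m + t) \<le> l (Suc (c + t)) - l (c + t)"
    using lift_Suc_mono_le[of "\<lambda>k. l (Suc k) - l k" "m + t" "c + t"] \<open>m \<le> c\<close> by simp
  with Suc.IH show ?case by simp
qed simp

text \<open>
  Increments grow with the index, so moving two indices apart with their sum fixed gains more at
  the upper one than it loses at the lower one.
\<close>

lemma convex_seq_exchange: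
  fixes l :: "nat \<Rightarrow> real"
  assumes "\<And>k. 2 * l (Suc k) \<le> l k + l (Suc (Suc k))" and "m \<le> b" "m \<le> c"
  shows "l b + l c \<le> l m + l (b + c - m)"
  using convex_seq_increment_mono[of l m c "b - m"] assms by (simp add: add.commute)

text \<open>
  The value \<open>l k\<close> is a sum of \<open>k\<close> increments, none of which exceeds a later one, so the slope of
  the chord from the origin grows. The division-free form covers \<open>k = 0\<close> and \<open>a = 0\<close>.
\<close>

lemma convex_seq_chord_mono:
  fixes l :: "nat \<Rightarrow> real"
  assumes convex: "\<And>k. 2 * l (Suc k) \<le> l k + l (Suc (Suc k))" and "l 0 = 0" and "k \<le> a"
  shows "real a * l k \<le> real k * l a"
  using \<open>k \<le> a\<close>
proof (induction a rule: dec_induct)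
  case base
  then show ?case by simp
next
  case (step a)
  have "l j \<le> real j * (l (Suc a) - l a)" if "j \<le> Suc a" for j
    using that
  proof (induction j)
    case (Suc j)
    have "l (Suc j) - l j \<le> l (Suc a) - l a"
      using convex_seq_increment_mono[of l j a 1] convex Suc.prems by simp
    with Suc show ?case by (simp add: algebra_simps)
  qed (simp add: \<open>l 0 = 0\<close>)
  from this[of k] step show ?case by (simp add: algebra_simps)
qed

section \<open>Return probabilities along even times\<close>

text \<open>
  For a symmetric walk \<open>u (j + k)\<close> is the inner product of its laws at the times \<open>j\<close> and \<open>k\<close>.
  The inequalities below then follow from the Cauchy--Schwarz inequality and from the
  invariance of the inner product under translations.
\<close>

locale symmetric_return_sequence =
  fixes u :: "nat \<Rightarrow> real"
  assumes u_0: "u 0 = 1"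
    and u_nonneg: "\<And>j. 0 \<le> u j"
    and u_le_even: "\<And>j. u j \<le> u (2 * (j div 2))"
    and u_even_pos: "\<And>k. 0 < u (2 * k)"
    and u_even_decreasing: "\<And>k. u (2 * Suc k) \<le> u (2 * k)"
    and u_even_log_convex: "\<And>k. (u (2 * Suc k))\<^sup>2 \<le> u (2 * k) * u (2 * Suc (Suc k))"
begin

definition w :: "nat \<Rightarrow> real" where
  "w k = u (2 * k)"

lemma w_pos: "0 < w k" and w_0: "w 0 = 1"
  using u_even_pos u_0 by (simp_all add: w_def)

lemma w_nonzero: "w k \<noteq> 0"
  using w_pos[of k] by simp

lemma w_antimono: "j \<le> k \<Longrightarrow> w k \<le> w j"
  using lift_Suc_antimono_le[of w j k] u_even_decreasing by (simp add: w_def)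

lemma w_le_1: "w k \<le> 1"
  using w_antimono[of 0 k] w_0 by simp

lemma u_le_w: "u j \<le> w (j div 2)"
  using u_le_even by (simp add: w_def)

lemma u_le_1: "u j \<le> 1"
  using u_le_w w_le_1 by (rule order_trans)

lemma ln_w_convex: "2 * ln (w (Suc k)) \<le> ln (w k) + ln (w (Suc (Suc k)))"
proof -
  have "ln ((w (Suc k))\<^sup>2) \<le> ln (w k * w (Suc (Suc k)))"
  proof (rule iffD2[OF ln_le_cancel_iff])
    show "(w (Suc k))\<^sup>2 \<le> w k * w (Suc (Suc k))"
      using u_even_log_convex[of k] by (simp add: w_def)
  qed (simp_all add: w_pos w_nonzero)
  then show ?thesis
    by (simp add: ln_mult ln_realpow w_pos w_nonzero)
qed

text \<open>
  Among the ways to split a given length into two parts of at least \<open>m\<close>, the most unequal one gives the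
  largest product.
\<close>

lemma w_exchange:
  assumes "m \<le> b" "m \<le> c"
  shows "w b * w c \<le> w m * w (b + c - m)"
proof -
  have "ln (w b * w c) \<le> ln (w m * w (b + c - m))"
    using convex_seq_exchange[of "\<lambda>k. ln (w k)" m b c] ln_w_convex w_pos assms
    by (simp add: ln_mult w_nonzero)
  then show ?thesis
    using w_pos by (simp add: ln_le_cancel_iff)
qed

lemma ln_w_chord_mono: "k \<le> a \<Longrightarrow> real a * ln (w k) \<le> real k * ln (w a)"
  using convex_seq_chord_mono[of "\<lambda>k. ln (w k)" k a] ln_w_convex w_0 by simp

text \<open>
  Loops of half-length at most \<open>m a\<close> can be cut out of a bridge of half-length \<open>a\<close> at the cost of
  the constant factor \<open>C\<close>. Splittings of the bridge into two parts of half-length above \<open>m a\<close> are negligible, either because \<open>a \<le> 2 * m a + 1\<close>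
  rules them out or because a return after \<open>2 * m a\<close> steps is too unlikely. The \<open>1\<close> in
  \<open>a - m a - 1\<close> absorbs the rounding for loops of odd length.
\<close>

definition short_loop_bound :: "(nat \<Rightarrow> nat) \<Rightarrow> real \<Rightarrow> bool" where
  "short_loop_bound m C \<longleftrightarrow>
     (\<forall>\<^sub>F a in sequentially. w (a - m a - 1) \<le> C * w a) \<and>
     (\<forall>\<delta>>0. \<forall>\<^sub>F a in sequentially. real a * w (m a) \<le> \<delta> \<or> a \<le> 2 * m a + 1)"

text \<open>
  Under the doubling condition, \<open>m a = a div 2\<close> works since three doublings lead from \<open>a div 4\<close>
  beyond \<open>a\<close>. The slope \<open>ln (w a) / a\<close> increases to a limit \<open>x \<le> 0\<close>, and doubling gives \<open>x / 2 \<le> x\<close>.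
\<close>

lemma doubling_imp_short_loop_bound:
  assumes doubling: "\<forall>\<^sub>F k in sequentially. w k \<le> C * w (2 * k)"
  shows "(\<lambda>a. ln (w a) / real a) \<longlonglongrightarrow> 0"
    and "short_loop_bound (\<lambda>a. a div 2) (C * (C * C))"
proof -
  obtain K where K: "\<And>k. K \<le> k \<Longrightarrow> w k \<le> C * w (2 * k)"
    using doubling by (auto simp: eventually_sequentially)
  have C: "0 < C"
    using K[of K] w_pos[of K] w_pos[of "2 * K"] by (metis order_refl less_le_trans zero_less_mult_pos2)
  let ?f = "\<lambda>a. ln (w (Suc a)) / real (Suc a)"
  have inc: "incseq ?f"
  proof (rule incseq_SucI)
    fix a
    show "?f a \<le> ?f (Suc a)"
      using ln_w_chord_mono[of "Suc a" "Suc (Suc a)"] by (simp add: divide_simps mult.commute)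
  qed
  have le0: "?f a \<le> 0" for a
    using w_le_1[of "Suc a"] w_pos[of "Suc a"] by (simp add: divide_nonpos_pos)
  then have "\<forall>a. ?f a \<le> 0"
    by blast
  with inc obtain x where x: "?f \<longlonglongrightarrow> x"
    by (rule incseq_convergent)
  then have lim: "(\<lambda>a. ln (w a) / real a) \<longlonglongrightarrow> x"
    by (rule LIMSEQ_imp_Suc)
  have "x \<le> 0"
    by (rule LIMSEQ_le_const2[OF x]) (use le0 in auto)
  moreover have "x / 2 \<le> x"
  proof -
    have "(\<lambda>a. ln (w (2 * a)) / real (2 * a)) \<longlonglongrightarrow> x"
      by (rule filterlim_compose[OF lim])
        (rule filterlim_subseq, simp add: strict_mono_def)
    moreover have "(\<lambda>a. ln (w a) / real a / 2 - ln C / (2 * real a)) \<longlonglongrightarrow> x / 2 - 0"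
      by (intro tendsto_intros lim) (simp, real_asymp)
    moreover have "ln (w a) / real a / 2 - ln C / (2 * real a) \<le> ln (w (2 * a)) / real (2 * a)"
      if "K + 1 \<le> a" for a
    proof -
      have "ln (w a) \<le> ln (C * w (2 * a))"
        using K[of a] that C w_pos by (subst ln_le_cancel_iff) auto
      then have "ln (w a) - ln C \<le> ln (w (2 * a))"
        using C w_pos[of "2 * a"] by (simp add: ln_mult)
      then have "(ln (w a) - ln C) / (2 * real a) \<le> ln (w (2 * a)) / (2 * real a)"
        by (intro divide_right_mono) auto
      then show ?thesis
        by (simp add: diff_divide_distrib)
    qed
    ultimately show ?thesis
      by (intro LIMSEQ_le[of _ "x / 2" _ x]) auto
  qed
  ultimately show "(\<lambda>a. ln (w a) / real a) \<longlonglongrightarrow> 0"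
    using lim by simp
  \<comment> \<open>Three factors \<open>C\<close>: \<open>a div 4\<close> lies below \<open>a - a div 2 - 1\<close>, and \<open>8 * (a div 4)\<close> lies above \<open>a\<close>.\<close>
  have "w (a - a div 2 - 1) \<le> C * (C * C) * w a" if a: "4 * K + 8 \<le> a" for a
  proof -
    define k where "k = a div 4"
    have k: "K \<le> k" "k \<le> a - a div 2 - 1" "a \<le> 8 * k"
      using a unfolding k_def by linarith+
    have "w (a - a div 2 - 1) \<le> w k"
      using k by (intro w_antimono) auto
    also have "\<dots> \<le> C * w (2 * k)"
      using K k by simp
    also have "\<dots> \<le> C * (C * w (4 * k))"
      using K[of "2 * k"] k C by simp
    also have "\<dots> \<le> C * (C * (C * w (8 * k)))"
      using K[of "4 * k"] k C by simp
    also have "\<dots> \<le> C * (C * (C * w a))"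
      using w_antimono[OF k(3)] C by simp
    finally show ?thesis by simp
  qed
  moreover have "a \<le> 2 * (a div 2) + 1" for a :: nat
    by presburger
  ultimately show "short_loop_bound (\<lambda>a. a div 2) (C * (C * C))"
    unfolding short_loop_bound_def eventually_sequentially by blast
qed

text \<open>
  Log-convexity and \<open>exp (- g a) \<le> w a\<close> bound the cost of cutting out a loop of half-length \<open>i\<close> by
  \<open>exp (i * g a / a)\<close>, which stays bounded for \<open>i\<close> up to the order of \<open>a / g a\<close>.
\<close>

lemma sandwich_imp_short_loop_bound:
  fixes g h :: "nat \<Rightarrow> real"
  assumes g_infinite: "filterlim g at_top sequentially"
    and g_sublinear: "(\<lambda>n. 1 / real n * g n) \<longlonglongrightarrow> 0"
    and h_small: "((\<lambda>n. real n * h (nat \<lfloor>real n / g (n div 2)\<rfloor>)) \<longlongrightarrow> 0) (multiples_at_top 2)"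
    and bounds: "\<forall>\<^sub>F n in sequentially. exp (- g n) \<le> w n \<and> w n \<le> h n"
  shows "(\<lambda>a. ln (w a) / real a) \<longlonglongrightarrow> 0"
    and "short_loop_bound (\<lambda>a. nat \<lfloor>real (2 * a) / g a\<rfloor>) (exp 3)"
proof -
  define m where "m a = nat \<lfloor>real (2 * a) / g a\<rfloor>" for a
  have ln_lower: "\<forall>\<^sub>F a in sequentially. - g a \<le> ln (w a)"
    using bounds
  proof eventually_elim
    case (elim a)
    then have "ln (exp (- g a)) \<le> ln (w a)"
      using w_pos by (subst ln_le_cancel_iff) auto
    then show ?case by simp
  qed
  have pos: "\<forall>\<^sub>F a::nat in sequentially. 0 < a"
    by (rule eventually_gt_at_top)
  show "(\<lambda>a. ln (w a) / real a) \<longlonglongrightarrow> 0"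
  proof (rule tendsto_sandwich)
    show "\<forall>\<^sub>F a in sequentially. - (1 / real a * g a) \<le> ln (w a) / real a"
      using ln_lower pos by eventually_elim (simp add: divide_simps)
    show "\<forall>\<^sub>F a in sequentially. ln (w a) / real a \<le> 0"
      using w_le_1 w_pos by (intro always_eventually allI divide_nonpos_nonneg) auto
    show "(\<lambda>a. - (1 / real a * g a)) \<longlonglongrightarrow> 0"
      using tendsto_minus[OF g_sublinear] by simp
  qed simp
  \<comment> \<open>This makes \<open>m a \<le> a / 4\<close>, so that \<open>a - m a - 1\<close> is not truncated.\<close>
  have g_large: "\<forall>\<^sub>F a in sequentially. 8 \<le> g a"
    using g_infinite by (auto simp: filterlim_at_top)
  have g_small: "\<forall>\<^sub>F a in sequentially. g a / real a < 1"
    using order_tendstoD(2)[OF g_sublinear, of 1] by simp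
  have "\<forall>\<^sub>F a in sequentially. w (a - m a - 1) \<le> exp 3 * w a"
    using ln_lower g_large g_small eventually_ge_at_top[of 2]
  proof eventually_elim
    case (elim a)
    define i where "i = m a + 1"
    have "real (2 * a) / g a \<le> real (2 * a) / 8"
      using elim by (intro divide_left_mono) auto
    moreover have m_le: "real (m a) \<le> real (2 * a) / g a"
      unfolding m_def using elim by (intro of_nat_floor) auto
    ultimately have "real (m a) \<le> real a / 4" by simp
    then have i: "i \<le> a"
      using elim unfolding i_def by linarith
    have "real a * ln (w (a - i)) \<le> real (a - i) * ln (w a)"
      by (rule ln_w_chord_mono) simp
    then have "real a * (ln (w (a - i)) - ln (w a)) \<le> real i * (- ln (w a))"
      using i by (simp add: of_nat_diff algebra_simps)
    also have "\<dots> \<le> real i * g a"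
      using elim by (intro mult_left_mono) auto
    also have "\<dots> \<le> (real (2 * a) / g a + 1) * g a"
      using m_le elim unfolding i_def by (intro mult_right_mono) auto
    also have "\<dots> \<le> real a * 3"
      using elim by (simp add: field_simps)
    finally have "ln (w (a - i)) \<le> ln (exp 3 * w a)"
      using elim w_pos[of a] by (simp add: ln_mult)
    then have "w (a - i) \<le> exp 3 * w a"
      using w_pos by (subst (asm) ln_le_cancel_iff) auto
    then show ?case
      by (simp add: i_def)
  qed
  moreover have "\<forall>\<^sub>F a in sequentially. real a * w (m a) \<le> \<delta> \<or> a \<le> 2 * m a + 1" if "0 < \<delta>" for \<delta>
  proof -
    have "filterlim (\<lambda>a::nat. 2 * a) (multiples_at_top 2) sequentially"
      unfolding multiples_at_top_def filterlim_inf filterlim_principal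
      by (intro conjI filterlim_subseq) (auto simp: strict_mono_def)
    from filterlim_compose[OF h_small this]
    have "(\<lambda>a. real (2 * a) * h (m a)) \<longlonglongrightarrow> 0"
      by (simp add: m_def)
    then have "\<forall>\<^sub>F a in sequentially. real (2 * a) * h (m a) < \<delta>"
      using that by (rule order_tendstoD(2))
    moreover have "filterlim m at_top sequentially"
    proof -
      have "filterlim (\<lambda>a. inverse (g a / real a)) at_top sequentially"
      proof (rule filterlim_inverse_at_top)
        show "(\<lambda>a. g a / real a) \<longlonglongrightarrow> 0" using g_sublinear by simp
        show "\<forall>\<^sub>F a in sequentially. 0 < g a / real a"
          using g_large pos by eventually_elim simp
      qed
      then have "filterlim (\<lambda>a. real (2 * a) / g a) at_top sequentially"
      proof (rule filterlim_at_top_mono)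
        show "\<forall>\<^sub>F a in sequentially. inverse (g a / real a) \<le> real (2 * a) / g a"
          using g_large pos by eventually_elim (simp add: divide_simps)
      qed
      then show ?thesis
        unfolding m_def
        by (intro filterlim_compose[OF filterlim_nat_sequentially] 
            filterlim_compose[OF filterlim_floor_sequentially])
    qed
    from eventually_compose_filterlim[OF bounds this]
    have "\<forall>\<^sub>F a in sequentially. w (m a) \<le> h (m a)"
      by eventually_elim simp
    ultimately show ?thesis
    proof eventually_elim
      case (elim a)
      have "real a * w (m a) \<le> real (2 * a) * h (m a)"
        using elim w_pos[of "m a"] by (intro mult_mono) auto
      with elim show ?case by simp
    qed
  qed
  ultimately have "short_loop_bound m (exp 3)"
    unfolding short_loop_bound_def by blast
  then show "short_loop_bound (\<lambda>a. nat \<lfloor>real (2 * a) / g a\<rfloor>) (exp 3)"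
    unfolding m_def .
qed

text \<open>
  The summand with index \<open>j\<close> is the joint probability of the bridge and of the \<open>n - j\<close> possible loops
  of length \<open>j\<close>. A short loop costs \<open>u j\<close>, whose tail sum is small. If the rest of the
  bridge is short, the small number \<open>n - j\<close> of positions is decisive. In all other cases,
  log-convexity moves the split to the extreme position \<open>m a\<close>.
\<close>

lemma long_loops_negligible:
  assumes summable: "summable u" and bound: "short_loop_bound m C" and "0 < \<epsilon>"
  shows "\<exists>N0. \<forall>N\<ge>N0. \<forall>\<^sub>F n in sequentially.
           (\<Sum>j\<in>{N<..<n}. real (n - j) * (u j * u (n - j))) \<le> \<epsilon> * real n * w (n div 2)"
proof -
  \<comment> \<open>The three ranges of \<open>j\<close> contribute \<open>C' * n * w a\<close> times \<open>\<eta>\<close>, \<open>2 * \<eta>\<close> and \<open>3 * \<eta>\<close>, hence the \<open>6\<close>.\<close>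
  define C' where "C' = max C 1"
  have C': "0 < C'" by (simp add: C'_def)
  define \<eta> where "\<eta> = \<epsilon> / (6 * C')"
  have \<eta>: "0 < \<eta>" using \<open>0 < \<epsilon>\<close> C' by (simp add: \<eta>_def)
  define U where "U = suminf u"
  have U: "0 \<le> U" unfolding U_def using suminf_nonneg[OF summable] u_nonneg by simp
  have fin_le: "sum u A \<le> U" if "finite A" for A
    unfolding U_def by (rule sum_le_suminf[OF summable that]) (use u_nonneg in auto)
  obtain N0 where N0: "\<And>N n. N0 \<le> N \<Longrightarrow> sum u {N<..<n} \<le> \<eta>"
  proof -
    obtain N0 where *: "\<And>k n. N0 \<le> k \<Longrightarrow> norm (sum u {k..<n}) < \<eta>"
      using summable \<eta> unfolding summable_Cauchy by blast
    show ?thesis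
    proof (rule that[of N0])
      fix N n assume "N0 \<le> N"
      have "sum u {N<..<n} = sum u {Suc N..<n}"
        by (rule arg_cong[where f = "sum u"]) auto
      also have "\<dots> \<le> \<eta>"
        using *[of "Suc N" n] \<open>N0 \<le> N\<close> by simp
      finally show "sum u {N<..<n} \<le> \<eta>" .
    qed
  qed
  have "\<forall>\<^sub>F n in sequentially.
      (\<Sum>j\<in>{N<..<n}. real (n - j) * (u j * u (n - j))) \<le> \<epsilon> * real n * w (n div 2)"
    if N: "N0 \<le> N" for N
  proof -
    have ev: "\<forall>\<^sub>F a in sequentially.
        w (a - m a - 1) \<le> C * w a \<and> (real a * w (m a) \<le> \<eta> \<or> a \<le> 2 * m a + 1)"
      using bound \<eta> unfolding short_loop_bound_def by (intro eventually_conj) blast+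
    have half: "filterlim (\<lambda>n::nat. n div 2) at_top sequentially"
      unfolding filterlim_at_top
    proof
      fix Z :: nat
      show "\<forall>\<^sub>F n in sequentially. Z \<le> n div 2"
        using eventually_ge_at_top[of "2 * Z"] by eventually_elim simp
    qed
    have "\<forall>\<^sub>F n::nat in sequentially. real N * U \<le> \<eta> * real n"
      using \<eta> by real_asymp
    with eventually_compose_filterlim[OF ev half] eventually_ge_at_top[of 2]
    show ?thesis
    proof eventually_elim
      case (elim n)
      define a where "a = n div 2"
      define D where "D = C' * w a"
      have D: "0 < D" using C' w_pos by (simp add: D_def)
      have "w (a - m a - 1) \<le> C * w a"
        using elim(1) by (simp add: a_def)
      also have "\<dots> \<le> D"
        unfolding D_def C'_def by (intro mult_right_mono) (simp_all add: w_pos less_imp_le)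
      finally have cut: "w (a - m a - 1) \<le> D" .
      have a: "1 \<le> a" "n \<le> 3 * a"
        using elim(2) unfolding a_def by presburger+
      have short: "u i * u (n - i) \<le> D * u i" if "i div 2 \<le> m a" "i \<le> n" for i
      proof -
        have "a - m a - 1 \<le> (n - i) div 2"
          using that unfolding a_def by linarith
        then have "u (n - i) \<le> D"
          using u_le_w[of "n - i"] w_antimono cut by (meson order_trans)
        then show ?thesis
          using mult_left_mono[of "u (n - i)" D "u i"] u_nonneg[of i] by (simp add: mult.commute)
      qed
      have summand: "real (n - j) * (u j * u (n - j))
          \<le> D * (real n * u j + real (n - j) * u (n - j) + 3 * \<eta>)"
        if j: "j \<in> {N<..<n}" for j
      proof -
        have nonneg: "0 \<le> u j" "0 \<le> u (n - j)" by (rule u_nonneg)+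
        consider "j div 2 \<le> m a" | "(n - j) div 2 \<le> m a" | "m a < j div 2" "m a < (n - j) div 2"
          by linarith
        then show ?thesis
        proof cases
          case 1
          have "real (n - j) * (u j * u (n - j)) \<le> real n * (D * u j)"
            using short[OF 1] j by (intro mult_mono[OF _ short[OF 1]] mult_nonneg_nonneg nonneg) auto
          moreover have "0 \<le> D * (real (n - j) * u (n - j) + 3 * \<eta>)"
            using nonneg D \<eta> by simp
          ultimately show ?thesis
            by (simp add: algebra_simps)
        next
          case 2
          have "u (n - j) * u (n - (n - j)) \<le> D * u (n - j)"
            by (rule short[OF 2]) simp
          then have "real (n - j) * (u j * u (n - j)) \<le> real (n - j) * (D * u (n - j))"
            using j by (intro mult_left_mono) (auto simp: mult.commute)
          moreover have "0 \<le> D * (real n * u j + 3 * \<eta>)"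
            using nonneg D \<eta> by simp
          ultimately show ?thesis
            by (simp add: algebra_simps)
        next
          case 3
          \<comment> \<open>Rounding loses at most one: if \<open>j\<close> and \<open>n - j\<close> are odd, then \<open>?b + ?c = a - 1\<close>.\<close>
          let ?b = "j div 2" and ?c = "(n - j) div 2"
          have "a - 1 \<le> ?b + ?c" "?b + ?c \<le> a"
            using j unfolding a_def greaterThanLessThan_iff by linarith+
          moreover from this have "\<not> a \<le> 2 * m a + 1"
            using 3 by linarith
          ultimately have middle: "real a * w (m a) \<le> \<eta>"
            using elim(1) by (simp add: a_def)
          have "u j * u (n - j) \<le> w ?b * w ?c"
            using nonneg w_pos[of ?b] u_le_w by (intro mult_mono) auto
          also have "\<dots> \<le> w (m a) * w (?b + ?c - m a)"
            using 3 by (intro w_exchange) auto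
          also have "\<dots> \<le> w (m a) * D"
          proof (rule mult_left_mono)
            have "a - m a - 1 \<le> ?b + ?c - m a"
              using \<open>a - 1 \<le> ?b + ?c\<close> by linarith
            then show "w (?b + ?c - m a) \<le> D"
              using w_antimono cut by (meson order_trans)
          qed (simp add: w_pos less_imp_le)
          finally have product: "u j * u (n - j) \<le> w (m a) * D" .
          have "real (n - j) * (u j * u (n - j)) \<le> real (3 * a) * (w (m a) * D)"
            using a j nonneg by (intro mult_mono[OF _ product]) auto
          also have "\<dots> = 3 * D * (real a * w (m a))"
            by simp
          also have "\<dots> \<le> 3 * D * \<eta>"
            using middle D by (intro mult_left_mono) auto
          finally have "real (n - j) * (u j * u (n - j)) \<le> 3 * D * \<eta>" .
          moreover have "0 \<le> D * (real n * u j + real (n - j) * u (n - j))"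
            using nonneg D by simp
          ultimately show ?thesis
            by (simp add: algebra_simps)
        qed
      qed
      have reversed: "(\<Sum>j\<in>{N<..<n}. real (n - j) * u (n - j)) \<le> 2 * \<eta> * real n"
      proof -
        have "(\<Sum>j\<in>{N<..<n}. real (n - j) * u (n - j)) = (\<Sum>i\<in>{0<..<n - N}. real i * u i)"
          by (rule sum.reindex_bij_witness[of _ "\<lambda>i. n - i" "\<lambda>j. n - j"]) auto
        also have "\<dots> \<le> (\<Sum>i\<in>{..N} \<union> {N<..<n}. real i * u i)"
          using u_nonneg by (intro sum_mono2) auto
        also have "\<dots> = (\<Sum>i\<le>N. real i * u i) + (\<Sum>i\<in>{N<..<n}. real i * u i)"
          by (intro sum.union_disjoint) auto
        also have "\<dots> \<le> (\<Sum>i\<le>N. real N * u i) + (\<Sum>i\<in>{N<..<n}. real n * u i)"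
          using u_nonneg by (intro add_mono sum_mono mult_right_mono) auto
        also have "\<dots> \<le> real N * U + real n * \<eta>"
          unfolding sum_distrib_left[symmetric]
          using fin_le N0[OF N] by (intro add_mono mult_left_mono) auto
        also have "\<dots> \<le> 2 * \<eta> * real n"
          using elim(3) by (simp add: algebra_simps)
        finally show ?thesis .
      qed
      have "(\<Sum>j\<in>{N<..<n}. real (n - j) * (u j * u (n - j)))
          \<le> (\<Sum>j\<in>{N<..<n}. D * (real n * u j + real (n - j) * u (n - j) + 3 * \<eta>))"
        by (intro sum_mono summand)
      also have "\<dots> = D * (real n * sum u {N<..<n} + (\<Sum>j\<in>{N<..<n}. real (n - j) * u (n - j))
                        + real (card {N<..<n}) * (3 * \<eta>))"
        by (simp add: sum.distrib sum_distrib_left[symmetric])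
      also have "\<dots> \<le> D * (real n * \<eta> + 2 * \<eta> * real n + real n * (3 * \<eta>))"
        using D \<eta> N0[OF N] reversed
        by (intro mult_left_mono add_mono mult_right_mono) auto
      also have "\<dots> = \<epsilon> * real n * w (n div 2)"
        using C' by (simp add: D_def \<eta>_def a_def field_simps)
      finally show ?case .
    qed
  qed
  then show ?thesis by blast
qed

end

section \<open>The range of a path\<close>

text \<open>
  A local version of being a last visit. It looks only at a window of \<open>N\<close> steps, so for a random
  walk it is independent for times that are at least \<open>N\<close> apart.
\<close>

definition fresh :: "nat \<Rightarrow> (nat \<Rightarrow> 'a) \<Rightarrow> nat \<Rightarrow> bool" where
  "fresh N S k \<longleftrightarrow> (\<forall>j\<in>{1..N}. S (k + j) \<noteq> S k)"

definition long_loops :: "nat \<Rightarrow> nat \<Rightarrow> (nat \<Rightarrow> 'a) \<Rightarrow> (nat \<times> nat) set" where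
  "long_loops N n S = {(k, j). N < j \<and> k + j < n \<and> S (k + j) = S k}"

lemma finite_long_loops: "finite (long_loops N n S)"
  by (rule finite_subset[of _ "{..<n} \<times> {..<n}"]) (auto simp: long_loops_def)

text \<open>
  Each point of the range has exactly one last visit.
\<close>

lemma card_range_eq_last_visits:
  fixes S :: "nat \<Rightarrow> 'a"
  shows "card (S ` {..<n}) = card {k\<in>{..<n}. \<forall>l\<in>{k<..<n}. S l \<noteq> S k}"
proof (rule sym, rule bij_betw_same_card)
  let ?L = "{k\<in>{..<n}. \<forall>l\<in>{k<..<n}. S l \<noteq> S k}"
  have "inj_on S ?L"
  proof (rule inj_onI)
    fix k l assume "k \<in> ?L" "l \<in> ?L" "S k = S l"
    then show "k = l" by (cases k l rule: linorder_cases) auto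
  qed
  moreover have "S ` {..<n} \<subseteq> S ` ?L"
  proof
    fix x assume "x \<in> S ` {..<n}"
    then obtain k0 where k0: "k0 < n" "S k0 = x" by auto
    define k where "k = Max {k\<in>{..<n}. S k = x}"
    have "k \<in> {k\<in>{..<n}. S k = x}"
      unfolding k_def using k0 by (intro Max_in) auto
    moreover have "l \<le> k" if "l < n" "S l = x" for l
      unfolding k_def using that by (intro Max_ge) auto
    ultimately have "k \<in> ?L" by (auto simp: not_less[symmetric])
    with \<open>k \<in> {k\<in>{..<n}. S k = x}\<close> show "x \<in> S ` ?L" by auto
  qed
  ultimately show "bij_betw S ?L (S ` {..<n})"
    unfolding bij_betw_def by auto
qed

text \<open>
  A last visit before time \<open>n\<close> is fresh unless its window reaches beyond \<open>n\<close>.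
\<close>

lemma card_range_le_fresh:
  fixes S :: "nat \<Rightarrow> 'a"
  shows "card (S ` {..<n}) \<le> card {k\<in>{..<n}. fresh N S k} + N"
proof -
  have "{k\<in>{..<n}. \<forall>l\<in>{k<..<n}. S l \<noteq> S k} \<subseteq> {k\<in>{..<n}. fresh N S k} \<union> {n - N..<n}"
    by (auto simp: fresh_def)
  then have "card {k\<in>{..<n}. \<forall>l\<in>{k<..<n}. S l \<noteq> S k}
      \<le> card ({k\<in>{..<n}. fresh N S k} \<union> {n - N..<n})"
    by (intro card_mono) auto
  also have "\<dots> \<le> card {k\<in>{..<n}. fresh N S k} + card {n - N..<n}"
    by (rule card_Un_le)
  finally show ?thesis
    unfolding card_range_eq_last_visits by simp
qed

text \<open>
  A fresh time that is not a last visit is the starting point of a long loop.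
\<close>

lemma fresh_le_card_range:
  fixes S :: "nat \<Rightarrow> 'a"
  shows "card {k\<in>{..<n}. fresh N S k} \<le> card (S ` {..<n}) + card (long_loops N n S)"
proof -
  let ?L = "{k\<in>{..<n}. \<forall>l\<in>{k<..<n}. S l \<noteq> S k}"
  have "{k\<in>{..<n}. fresh N S k} \<subseteq> ?L \<union> fst ` long_loops N n S"
  proof
    fix k assume k: "k \<in> {k\<in>{..<n}. fresh N S k}"
    show "k \<in> ?L \<union> fst ` long_loops N n S"
    proof (cases "k \<in> ?L")
      case False
      with k obtain l where l: "k < l" "l < n" "S l = S k" by auto
      have "\<not> l - k \<le> N"
        using k l by (auto simp: fresh_def dest: bspec[of _ _ "l - k"])
      with l have "(k, l - k) \<in> long_loops N n S"
        by (auto simp: long_loops_def)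
      then show ?thesis by force
    qed simp
  qed
  then have "card {k\<in>{..<n}. fresh N S k} \<le> card (?L \<union> fst ` long_loops N n S)"
    by (intro card_mono) (auto simp: finite_long_loops)
  also have "\<dots> \<le> card ?L + card (fst ` long_loops N n S)"
    by (rule card_Un_le)
  also have "\<dots> \<le> card ?L + card (long_loops N n S)"
    by (intro add_left_mono card_image_le finite_long_loops)
  finally show ?thesis
    unfolding card_range_eq_last_visits .
qed

section \<open>Random words with symmetric independent letters\<close>

lemma prob_cong_set_pmf:
  assumes "\<And>x. x \<in> set_pmf M \<Longrightarrow> x \<in> A \<longleftrightarrow> x \<in> B"
  shows "measure_pmf.prob M A = measure_pmf.prob M B"
  by (rule measure_pmf.finite_measure_eq_AE) (auto simp: AE_measure_pmf_iff assms)

lemma prob_pair_pmf_Times: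
  "measure_pmf.prob (pair_pmf M N) (A \<times> B) = measure_pmf.prob M A * measure_pmf.prob N B"
proof -
  have "measure_pmf.prob (pair_pmf M N) (A \<times> B) =
      measure_pmf.prob (pair_pmf M N) ((A \<inter> set_pmf M) \<times> (B \<inter> set_pmf N))"
    by (rule prob_cong_set_pmf) auto
  also have "\<dots> = measure_pmf.prob M (A \<inter> set_pmf M) * measure_pmf.prob N (B \<inter> set_pmf N)"
    by (rule measure_pmf_prob_product) (auto intro: countable_Int2)
  finally show ?thesis
    by (simp add: measure_Int_set_pmf)
qed

lemma replicate_pmf_add:
  "replicate_pmf (m + n) \<mu> = map_pmf (\<lambda>(xs, ys). xs @ ys) (pair_pmf (replicate_pmf m \<mu>) (replicate_pmf n \<mu>))"
  by (simp add: replicate_pmf_distrib pair_pmf_def map_bind_pmf)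

lemma prob_replicate_pmf_take_drop:
  assumes "j \<le> n"
  shows "measure_pmf.prob (replicate_pmf n \<mu>) {xs. P (take j xs) \<and> Q (drop j xs)} =
    measure_pmf.prob (replicate_pmf j \<mu>) {xs. P xs} * measure_pmf.prob (replicate_pmf (n - j) \<mu>) {xs. Q xs}"
proof -
  let ?W = "pair_pmf (replicate_pmf j \<mu>) (replicate_pmf (n - j) \<mu>)"
  have "measure_pmf.prob (replicate_pmf n \<mu>) {xs. P (take j xs) \<and> Q (drop j xs)} =
      measure_pmf.prob ?W ((\<lambda>(xs, ys). xs @ ys) -` {xs. P (take j xs) \<and> Q (drop j xs)})"
    using replicate_pmf_add[of j "n - j" \<mu>] assms by (simp add: measure_map_pmf)
  also have "\<dots> = measure_pmf.prob ?W ({xs. P xs} \<times> {xs. Q xs})"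
    by (rule prob_cong_set_pmf) (auto simp: set_replicate_pmf)
  finally show ?thesis
    by (simp add: prob_pair_pmf_Times)
qed

lemma prob_replicate_pmf_take:
  assumes "j \<le> n"
  shows "measure_pmf.prob (replicate_pmf n \<mu>) {xs. P (take j xs)} =
    measure_pmf.prob (replicate_pmf j \<mu>) {xs. P xs}"
  using prob_replicate_pmf_take_drop[OF assms, of \<mu> P "\<lambda>_. True"] by simp

text \<open>
  A factor in the middle of a word with independent letters is independent of what remains when it
  is deleted, and the rest is again such a word.
\<close>

lemma prob_replicate_pmf_cut:
  assumes "k + j \<le> n"
  shows "measure_pmf.prob (replicate_pmf n \<mu>)
      {xs. P (take j (drop k xs)) \<and> Q (take k xs @ drop (k + j) xs)} =
    measure_pmf.prob (replicate_pmf j \<mu>) {xs. P xs} * measure_pmf.prob (replicate_pmf (n - j) \<mu>) {xs. Q xs}"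
proof -
  define l where "l = n - (k + j)"
  have n: "n = k + (j + l)" "n - j = k + l"
    using assms by (simp_all add: l_def)
  let ?R = "\<lambda>i. replicate_pmf i \<mu>"
  let ?W = "pair_pmf (?R j) (pair_pmf (?R k) (?R l))"
  let ?A = "{xs. P (take j (drop k xs)) \<and> Q (take k xs @ drop (k + j) xs)}"
  have "?R n = bind_pmf (?R k) (\<lambda>a. bind_pmf (?R j) (\<lambda>b. bind_pmf (?R l) (\<lambda>c. return_pmf (a @ b @ c))))"
    unfolding n replicate_pmf_distrib by (simp add: bind_assoc_pmf bind_return_pmf)
  also have "\<dots> = bind_pmf (?R j) (\<lambda>b. bind_pmf (?R k) (\<lambda>a. bind_pmf (?R l) (\<lambda>c. return_pmf (a @ b @ c))))"
    by (rule bind_commute_pmf)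
  also have "\<dots> = map_pmf (\<lambda>(b, a, c). a @ b @ c) ?W"
    by (simp add: pair_pmf_def map_bind_pmf bind_assoc_pmf bind_return_pmf)
  finally have "measure_pmf.prob (?R n) ?A = measure_pmf.prob ?W ((\<lambda>(b, a, c). a @ b @ c) -` ?A)"
    by (simp add: measure_map_pmf)
  also have "\<dots> = measure_pmf.prob ?W ({xs. P xs} \<times> {(a, c). Q (a @ c)})"
    by (rule prob_cong_set_pmf) (auto simp: set_replicate_pmf)
  also have "\<dots> = measure_pmf.prob (?R j) {xs. P xs} * measure_pmf.prob (?R (k + l)) {xs. Q xs}"
    by (simp add: prob_pair_pmf_Times replicate_pmf_add measure_map_pmf vimage_def case_prod_beta')
  finally show ?thesis
    by (simp add: n)
qed

definition (in monoid) word_prod :: "'a list \<Rightarrow> 'a" where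
  "word_prod xs = foldl (\<otimes>) \<one> xs"

context monoid
begin

lemma word_prod_Nil: "word_prod [] = \<one>"
  by (simp add: word_prod_def)

lemma word_prod_snoc: "word_prod (xs @ [x]) = word_prod xs \<otimes> x"
  by (simp add: word_prod_def)

lemma word_prod_closed: "set xs \<subseteq> carrier G \<Longrightarrow> word_prod xs \<in> carrier G"
  by (induction xs rule: rev_induct) (auto simp: word_prod_Nil word_prod_snoc)

lemma word_prod_append:
  assumes "set xs \<subseteq> carrier G" "set ys \<subseteq> carrier G"
  shows "word_prod (xs @ ys) = word_prod xs \<otimes> word_prod ys"
  using assms(2)
proof (induction ys rule: rev_induct)
  case (snoc y ys)
  then have "word_prod (xs @ ys @ [y]) = word_prod (xs @ ys) \<otimes> y"
    using word_prod_snoc[of "xs @ ys" y] by simp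
  with snoc show ?case
    using word_prod_closed assms(1) by (simp add: word_prod_snoc m_assoc)
qed (simp add: word_prod_Nil word_prod_closed assms(1))

end

locale symmetric_step_law = group G for G :: "('a, 'b) monoid_scheme" (structure) +
  fixes \<mu> :: "'a pmf"
  assumes finite_support: "finite (set_pmf \<mu>)"
    and support_closed: "set_pmf \<mu> \<subseteq> carrier G"
    and symmetric_law: "map_pmf (\<lambda>x. inv x) \<mu> = \<mu>"
begin

definition law :: "nat \<Rightarrow> 'a pmf" where
  "law n = map_pmf word_prod (replicate_pmf n \<mu>)"

definition returns :: "nat \<Rightarrow> real" where
  "returns n = pmf (law n) \<one>"

lemma word_closed: "xs \<in> set_pmf (replicate_pmf n \<mu>) \<Longrightarrow> set xs \<subseteq> carrier G"
  using support_closed by (auto simp: set_replicate_pmf)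

lemma word_length: "xs \<in> set_pmf (replicate_pmf n \<mu>) \<Longrightarrow> length xs = n"
  by (simp add: set_replicate_pmf)

lemma returns_eq_prob: "returns n = measure_pmf.prob (replicate_pmf n \<mu>) {xs. word_prod xs = \<one>}"
  by (simp add: returns_def law_def pmf_map vimage_def)

lemma finite_law: "finite (set_pmf (law n))"
  unfolding law_def set_map_pmf set_replicate_pmf
  using finite_lists_length_eq[OF finite_support] by (intro finite_imageI) (simp add: lists_eq_set conj_commute)

lemma law_closed: "x \<in> set_pmf (law n) \<Longrightarrow> x \<in> carrier G"
  by (auto simp: law_def intro: word_prod_closed[OF word_closed])

lemma law_0: "law 0 = return_pmf \<one>"
  by (simp add: law_def word_prod_Nil)

lemma law_1: "law 1 = \<mu>"
proof -
  have "law 1 = map_pmf (\<lambda>x. word_prod [x]) \<mu>"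
    unfolding law_def replicate_pmf_1 by (simp add: map_pmf_comp)
  also have "\<dots> = map_pmf (\<lambda>x. x) \<mu>"
    by (rule map_pmf_cong) (use support_closed in \<open>auto simp: word_prod_def\<close>)
  finally show ?thesis by simp
qed

lemma law_add: "law (m + n) = map_pmf (\<lambda>(x, y). x \<otimes> y) (pair_pmf (law m) (law n))"
proof -
  have "law (m + n) = map_pmf (\<lambda>(xs, ys). word_prod (xs @ ys))
      (pair_pmf (replicate_pmf m \<mu>) (replicate_pmf n \<mu>))"
    unfolding law_def replicate_pmf_add by (simp add: map_pmf_comp case_prod_beta')
  also have "\<dots> = map_pmf (\<lambda>(xs, ys). word_prod xs \<otimes> word_prod ys)
      (pair_pmf (replicate_pmf m \<mu>) (replicate_pmf n \<mu>))"
    by (rule map_pmf_cong) (auto intro!: word_prod_append dest: word_closed)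
  finally show ?thesis
    unfolding law_def map_pair[symmetric] by (simp add: map_pmf_comp map_prod_def case_prod_beta')
qed

text \<open>
  The inverse of a product is the product of the inverses in reverse order, and independent letters may
  be reversed.
\<close>

lemma law_inv: "map_pmf (\<lambda>x. inv x) (law n) = law n"
proof (induction n)
  case 0
  then show ?case by (simp add: law_0)
next
  case (Suc n)
  have "map_pmf (\<lambda>x. inv x) (law (n + 1)) = map_pmf (\<lambda>(x, y). inv (x \<otimes> y)) (pair_pmf (law n) (law 1))"
    unfolding law_add by (simp add: map_pmf_comp case_prod_beta')
  also have "\<dots> = map_pmf (\<lambda>(x, y). inv y \<otimes> inv x) (pair_pmf (law n) (law 1))"
    by (rule map_pmf_cong) (auto dest!: law_closed simp: inv_mult_group)
  also have "\<dots> = map_pmf (\<lambda>(y, x). inv y \<otimes> inv x) (pair_pmf (law 1) (law n))"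
    by (subst pair_commute_pmf) (simp add: map_pmf_comp case_prod_beta')
  also have "\<dots> = map_pmf (\<lambda>(y, x). y \<otimes> x) (pair_pmf (map_pmf (\<lambda>x. inv x) (law 1)) (map_pmf (\<lambda>x. inv x) (law n)))"
    unfolding map_pair[symmetric] by (simp add: map_pmf_comp map_prod_def case_prod_beta')
  also have "\<dots> = law (1 + n)"
    unfolding law_add by (simp add: Suc.IH symmetric_law law_1[simplified])
  finally show ?case by simp
qed

lemma pmf_law_inv: "x \<in> carrier G \<Longrightarrow> pmf (law n) (inv x) = pmf (law n) x"
proof -
  assume x: "x \<in> carrier G"
  have "pmf (law n) (inv x) = pmf (map_pmf (\<lambda>x. inv x) (law n)) (inv x)"
    by (simp add: law_inv)
  also have "\<dots> = measure_pmf.prob (law n) {x}"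
    unfolding pmf_map using x by (intro prob_cong_set_pmf) (auto dest: law_closed inj_onD[OF inv_inj])
  finally show ?thesis
    by (simp add: measure_pmf_single)
qed

lemma pmf_law_add:
  assumes z: "z \<in> carrier G"
  shows "pmf (law (m + n)) z = (\<Sum>x\<in>set_pmf (law m). pmf (law m) x * pmf (law n) (inv x \<otimes> z))"
proof -
  have "law (m + n) = bind_pmf (law m) (\<lambda>x. map_pmf (\<lambda>y. x \<otimes> y) (law n))"
    unfolding law_add pair_pmf_def map_bind_pmf by (simp add: map_pmf_def bind_assoc_pmf bind_return_pmf)
  then have "pmf (law (m + n)) z
      = measure_pmf.expectation (law m) (\<lambda>x. pmf (map_pmf (\<lambda>y. x \<otimes> y) (law n)) z)"
    by (simp add: pmf_bind)
  also have "\<dots> = (\<Sum>x\<in>set_pmf (law m). pmf (law m) x * pmf (map_pmf (\<lambda>y. x \<otimes> y) (law n)) z)"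
    by (subst integral_measure_pmf[OF finite_law]) auto
  also have "\<dots> = (\<Sum>x\<in>set_pmf (law m). pmf (law m) x * pmf (law n) (inv x \<otimes> z))"
  proof (intro sum.cong refl arg_cong2[where f = "(*)"])
    fix x assume x: "x \<in> set_pmf (law m)"
    have "pmf (map_pmf (\<lambda>y. x \<otimes> y) (law n)) z = measure_pmf.prob (law n) {inv x \<otimes> z}"
      unfolding pmf_map
    proof (intro prob_cong_set_pmf)
      fix y assume "y \<in> set_pmf (law n)"
      then show "y \<in> (\<lambda>y. x \<otimes> y) -` {z} \<longleftrightarrow> y \<in> {inv x \<otimes> z}"
        using x z law_closed inv_solve_left[of y x z] by auto
    qed
    then show "pmf (map_pmf (\<lambda>y. x \<otimes> y) (law n)) z = pmf (law n) (inv x \<otimes> z)"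
      by (simp add: measure_pmf_single)
  qed
  finally show ?thesis .
qed

text \<open>
  The inner product formula from which the Cauchy--Schwarz arguments start.
\<close>

lemma returns_add: "returns (m + n) = (\<Sum>x\<in>set_pmf (law m). pmf (law m) x * pmf (law n) x)"
  unfolding returns_def by (subst pmf_law_add) (auto intro!: sum.cong simp: pmf_law_inv dest: law_closed)

lemma returns_nonneg: "0 \<le> returns n"
  by (simp add: returns_def)

lemma sum_square_law_le:
  assumes "finite A"
  shows "(\<Sum>x\<in>A. (pmf (law n) x)\<^sup>2) \<le> returns (2 * n)"
proof -
  have "(\<Sum>x\<in>A. (pmf (law n) x)\<^sup>2) = (\<Sum>x\<in>A \<inter> set_pmf (law n). (pmf (law n) x)\<^sup>2)"
    using assms by (intro sum.mono_neutral_right) (auto simp: set_pmf_iff)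
  also have "\<dots> \<le> (\<Sum>x\<in>set_pmf (law n). (pmf (law n) x)\<^sup>2)"
    by (intro sum_mono2 finite_law) auto
  also have "\<dots> = returns (2 * n)"
    unfolding mult_2 returns_add by (simp add: power2_eq_square)
  finally show ?thesis .
qed

text \<open>
  At even times a symmetric random walk is most likely to be at the identity: the probability of
  \<open>z\<close> is the inner product of the law at half the time with a translate of it, and translation
  preserves the norm.
\<close>

lemma pmf_law_even_le:
  assumes z: "z \<in> carrier G"
  shows "pmf (law (2 * k)) z \<le> returns (2 * k)"
proof -
  let ?S = "set_pmf (law k)"
  have inj: "inj_on (\<lambda>x. inv x \<otimes> z) ?S"
    using z by (intro inj_onI) (auto dest!: law_closed dest: inj_onD[OF inv_inj])
  have "pmf (law (2 * k)) z = (\<Sum>x\<in>?S. pmf (law k) x * pmf (law k) (inv x \<otimes> z))"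
    unfolding mult_2 by (rule pmf_law_add[OF z])
  also have "\<dots> \<le> (\<Sum>x\<in>?S. ((pmf (law k) x)\<^sup>2 + (pmf (law k) (inv x \<otimes> z))\<^sup>2) / 2)"
  proof (rule sum_mono)
    fix x
    show "pmf (law k) x * pmf (law k) (inv x \<otimes> z) \<le> ((pmf (law k) x)\<^sup>2 + (pmf (law k) (inv x \<otimes> z))\<^sup>2) / 2"
      using sum_squares_bound[of "pmf (law k) x" "pmf (law k) (inv x \<otimes> z)"] by simp
  qed
  also have "\<dots> = ((\<Sum>x\<in>?S. (pmf (law k) x)\<^sup>2) + (\<Sum>x\<in>(\<lambda>x. inv x \<otimes> z) ` ?S. (pmf (law k) x)\<^sup>2)) / 2"
    by (simp add: sum.distrib sum.reindex[OF inj] flip: sum_divide_distrib)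
  also have "\<dots> \<le> (returns (2 * k) + returns (2 * k)) / 2"
    by (intro divide_right_mono add_mono sum_square_law_le finite_imageI finite_law) simp
  finally show ?thesis by simp
qed

lemma returns_add_even_le: "returns (m + 2 * k) \<le> returns (2 * k)"
proof -
  have "returns (m + 2 * k) \<le> (\<Sum>x\<in>set_pmf (law m). pmf (law m) x * returns (2 * k))"
    unfolding returns_add by (intro sum_mono mult_left_mono pmf_law_even_le) (auto dest: law_closed)
  also have "\<dots> = returns (2 * k)"
    by (simp add: sum_pmf_eq_1 finite_law flip: sum_distrib_right)
  finally show ?thesis .
qed

lemma returns_supermultiplicative: "returns m * returns n \<le> returns (m + n)"
proof (cases "\<one> \<in> set_pmf (law m)")
  case True
  have "returns m * returns n = (\<Sum>x\<in>{\<one>}. pmf (law m) x * pmf (law n) x)"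
    by (simp add: returns_def)
  also have "\<dots> \<le> returns (m + n)"
    unfolding returns_add using True by (intro sum_mono2 finite_law) auto
  finally show ?thesis .
next
  case False
  then show ?thesis
    using returns_nonneg by (simp add: returns_def set_pmf_iff)
qed

lemma returns_even_pos: "0 < returns (2 * k)"
proof (induction k)
  case 0
  then show ?case by (simp add: returns_def law_0)
next
  case (Suc k)
  have "0 < (\<Sum>x\<in>set_pmf (law 1). pmf (law 1) x * pmf (law 1) x)"
    by (intro sum_pos finite_law set_pmf_not_empty) (simp add: pmf_positive)
  then have "0 < returns 2"
    using returns_add[of 1 1] by (simp add: numeral_2_eq_2)
  then have "0 < returns 2 * returns (2 * k)"
    using Suc by simp
  also have "\<dots> \<le> returns (2 * Suc k)"
    using returns_supermultiplicative[of 2 "2 * k"] by simp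
  finally show ?case .
qed

sublocale symmetric_return_sequence returns
proof
  show "returns 0 = 1"
    by (simp add: returns_def law_0)
  fix j k
  show "0 \<le> returns j"
    by (rule returns_nonneg)
  show "0 < returns (2 * k)"
    by (rule returns_even_pos)
  show "returns (2 * Suc k) \<le> returns (2 * k)"
    using returns_add_even_le[of 2 k] by simp
  show "returns j \<le> returns (2 * (j div 2))"
    using returns_add_even_le[of "j mod 2" "j div 2"] by simp
  have "(returns (2 * Suc k))\<^sup>2 = (\<Sum>x\<in>set_pmf (law k). pmf (law k) x * pmf (law (k + 2)) x)\<^sup>2"
    using returns_add[of k "k + 2"] by (simp add: mult_2)
  also have "\<dots> \<le> (\<Sum>x\<in>set_pmf (law k). (pmf (law k) x)\<^sup>2) * (\<Sum>x\<in>set_pmf (law k). (pmf (law (k + 2)) x)\<^sup>2)"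
    by (rule Cauchy_Schwarz_ineq_sum)
  also have "\<dots> \<le> returns (2 * k) * returns (2 * (k + 2))"
    by (intro mult_mono sum_square_law_le finite_law returns_nonneg sum_nonneg) auto
  finally show "(returns (2 * Suc k))\<^sup>2 \<le> returns (2 * k) * returns (2 * Suc (Suc k))"
    by simp
qed

text \<open>
  Cutting a loop of length \<open>j\<close> out of a bridge of length \<open>n\<close> leaves a bridge of length \<open>n - j\<close>.
\<close>

lemma prob_loop_in_bridge:
  assumes "k + j \<le> n"
  shows "measure_pmf.prob (replicate_pmf n \<mu>)
      {xs. word_prod (take (k + j) xs) = word_prod (take k xs) \<and> word_prod xs = \<one>}
    = returns j * returns (n - j)"
proof -
  have "measure_pmf.prob (replicate_pmf n \<mu>)
      {xs. word_prod (take (k + j) xs) = word_prod (take k xs) \<and> word_prod xs = \<one>} =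
    measure_pmf.prob (replicate_pmf n \<mu>)
      {xs. word_prod (take j (drop k xs)) = \<one> \<and> word_prod (take k xs @ drop (k + j) xs) = \<one>}"
  proof (rule prob_cong_set_pmf)
    fix xs assume "xs \<in> set_pmf (replicate_pmf n \<mu>)"
    then have xs: "set xs \<subseteq> carrier G"
      by (rule word_closed)
    let ?a = "take k xs" and ?b = "take j (drop k xs)" and ?c = "drop (k + j) xs"
    have prefix: "take (k + j) xs = ?a @ ?b"
      by (rule take_add)
    then have split: "xs = (?a @ ?b) @ ?c"
      by (metis append_take_drop_id)
    have closed: "set ?a \<subseteq> carrier G" "set ?b \<subseteq> carrier G" "set ?c \<subseteq> carrier G"
      using xs by (meson order_trans set_take_subset set_drop_subset)+
    then have closed': "word_prod ?a \<in> carrier G" "word_prod ?b \<in> carrier G"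
      by (auto intro: word_prod_closed)
    have loop: "word_prod (take (k + j) xs) = word_prod ?a \<longleftrightarrow> word_prod ?b = \<one>"
      unfolding prefix using closed closed' by (simp add: word_prod_append)
    have "word_prod xs = word_prod ?a \<otimes> word_prod ?b \<otimes> word_prod ?c"
      using closed by (subst split, subst word_prod_append) (auto simp: word_prod_append)
    moreover have "word_prod (?a @ ?c) = word_prod ?a \<otimes> word_prod ?c"
      using closed by (simp add: word_prod_append)
    ultimately show "xs \<in> {xs. word_prod (take (k + j) xs) = word_prod (take k xs) \<and> word_prod xs = \<one>} \<longleftrightarrow>
        xs \<in> {xs. word_prod (take j (drop k xs)) = \<one> \<and> word_prod (take k xs @ drop (k + j) xs) = \<one>}"
      using loop closed' by auto
  qed
  also have "\<dots> = returns j * returns (n - j)"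
    using prob_replicate_pmf_cut[OF assms] by (simp add: returns_eq_prob)
  finally show ?thesis .
qed

end

section \<open>First returns and the renewal inequality\<close>

text \<open>
  Summing the renewal inequality over \<open>n \<le> K\<close> gives \<open>U \<le> 1 + F * U\<close> for the partial sum \<open>U\<close>
  of \<open>u\<close>, so that the partial sums stay below \<open>1 / (1 - F)\<close>.
\<close>

lemma renewal_imp_summable:
  fixes u f :: "nat \<Rightarrow> real"
  assumes u_nonneg: "\<And>n. 0 \<le> u n" and f_nonneg: "\<And>n. 0 \<le> f n" and "u 0 \<le> 1"
    and renewal: "\<And>n. 1 \<le> n \<Longrightarrow> u n \<le> (\<Sum>j=1..n. f j * u (n - j))"
    and f_sum: "\<And>n. (\<Sum>j=1..n. f j) \<le> F" and "F < 1"
  shows "summable u"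
proof (rule bounded_imp_summable)
  fix K
  define U where "U = sum u {..K}"
  have U: "0 \<le> U" by (simp add: U_def sum_nonneg u_nonneg)
  have "(\<Sum>n=1..K. u n) \<le> (\<Sum>n=1..K. \<Sum>j=1..K. if j \<le> n then f j * u (n - j) else 0)"
  proof (rule sum_mono)
    fix n assume n: "n \<in> {1..K}"
    have "u n \<le> (\<Sum>j=1..n. f j * u (n - j))"
      using renewal n by simp
    also have "\<dots> = (\<Sum>j=1..K. if j \<le> n then f j * u (n - j) else 0)"
      using n by (intro sum.mono_neutral_cong_left) auto
    finally show "u n \<le> (\<Sum>j=1..K. if j \<le> n then f j * u (n - j) else 0)" .
  qed
  also have "\<dots> = (\<Sum>j=1..K. \<Sum>n=1..K. if j \<le> n then f j * u (n - j) else 0)"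
    by (rule sum.swap)
  also have "\<dots> \<le> (\<Sum>j=1..K. f j * U)"
  proof (rule sum_mono)
    fix j assume j: "j \<in> {1..K}"
    have "(\<Sum>n=1..K. if j \<le> n then f j * u (n - j) else 0) = (\<Sum>n\<in>{j..K}. f j * u (n - j))"
      using j by (intro sum.mono_neutral_cong_right) auto
    also have "\<dots> = (\<Sum>i\<in>{..K - j}. f j * u i)"
      using j by (intro sum.reindex_bij_witness[of _ "\<lambda>i. i + j" "\<lambda>n. n - j"]) auto
    also have "\<dots> \<le> (\<Sum>i\<in>{..K}. f j * u i)"
      using u_nonneg f_nonneg by (intro sum_mono2) auto
    finally show "(\<Sum>n=1..K. if j \<le> n then f j * u (n - j) else 0) \<le> f j * U"
      by (simp add: U_def sum_distrib_left)
  qed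
  also have "\<dots> = (\<Sum>j=1..K. f j) * U"
    by (simp add: sum_distrib_right)
  also have "\<dots> \<le> F * U"
    using f_sum U by (intro mult_right_mono)
  finally have "sum u {..K} \<le> 1 + F * U"
    using \<open>u 0 \<le> 1\<close> by (simp add: atMost_atLeast0 sum.atLeast_Suc_atMost)
  then have "(1 - F) * U \<le> 1"
    by (simp add: U_def algebra_simps)
  then show "sum u {..K} \<le> 1 / (1 - F)"
    using \<open>F < 1\<close> by (simp add: U_def pos_le_divide_eq mult.commute)
qed (rule u_nonneg)

context symmetric_step_law
begin

definition first_return_word :: "'a list \<Rightarrow> bool" where
  "first_return_word xs \<longleftrightarrow>
     (\<forall>k\<in>{1..<length xs}. word_prod (take k xs) \<noteq> \<one>) \<and> word_prod xs = \<one>"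

definition first_returns :: "nat \<Rightarrow> real" where
  "first_returns n = measure_pmf.prob (replicate_pmf n \<mu>) {xs. first_return_word xs}"

lemma first_return_word_exists:
  assumes "word_prod (take n xs) = \<one>" "1 \<le> n" "n \<le> length xs"
  shows "\<exists>j\<in>{1..n}. first_return_word (take j xs)"
proof -
  let ?P = "\<lambda>j. 1 \<le> j \<and> word_prod (take j xs) = \<one>"
  define j where "j = (LEAST j. ?P j)"
  have "?P n"
    using assms by simp
  then have j: "?P j" "j \<le> n"
    unfolding j_def by (rule LeastI, rule Least_le)
  have "word_prod (take k (take j xs)) \<noteq> \<one>" if "k \<in> {1..<length (take j xs)}" for k
  proof -
    have "1 \<le> k" "k < j" using that by auto
    then show ?thesis
      using not_less_Least[of k ?P, folded j_def] by (simp add: min_def)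
  qed
  then have "first_return_word (take j xs)"
    using j by (simp add: first_return_word_def)
  with j show ?thesis by auto
qed

text \<open>
  Decompose according to the time \<open>j\<close> of the first return. The union bound suffices.
\<close>

lemma returns_renewal:
  assumes "1 \<le> n"
  shows "returns n \<le> (\<Sum>j=1..n. first_returns j * returns (n - j))"
proof -
  let ?R = "replicate_pmf n \<mu>"
  let ?A = "\<lambda>j. {xs. first_return_word (take j xs) \<and> word_prod (drop j xs) = \<one>}"
  have "returns n = measure_pmf.prob ?R ({xs. word_prod xs = \<one>} \<inter> set_pmf ?R)"
    by (simp add: returns_eq_prob measure_Int_set_pmf)
  also have "\<dots> \<le> measure_pmf.prob ?R (\<Union>j\<in>{1..n}. ?A j)"
  proof (rule measure_pmf.finite_measure_mono)
    show "{xs. word_prod xs = \<one>} \<inter> set_pmf ?R \<subseteq> (\<Union>j\<in>{1..n}. ?A j)"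
    proof
      fix xs assume "xs \<in> {xs. word_prod xs = \<one>} \<inter> set_pmf ?R"
      then have xs: "word_prod xs = \<one>" "length xs = n" "set xs \<subseteq> carrier G"
        by (auto dest: word_closed word_length)
      then obtain j where j: "j \<in> {1..n}" "first_return_word (take j xs)"
        using first_return_word_exists[of n xs] assms by auto
      have closed: "set (take j xs) \<subseteq> carrier G" "set (drop j xs) \<subseteq> carrier G"
        using xs by (meson order_trans set_take_subset set_drop_subset)+
      have "word_prod xs = word_prod (take j xs) \<otimes> word_prod (drop j xs)"
        using word_prod_append[OF closed] by simp
      moreover have "word_prod (take j xs) = \<one>"
        using j by (simp add: first_return_word_def)
      ultimately have "word_prod (drop j xs) = \<one>"
        using xs(1) word_prod_closed[OF closed(2)] by simp
      with j show "xs \<in> (\<Union>j\<in>{1..n}. ?A j)" by auto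
    qed
  qed simp
  also have "\<dots> \<le> (\<Sum>j=1..n. measure_pmf.prob ?R (?A j))"
    by (intro measure_pmf.finite_measure_subadditive_finite) auto
  also have "\<dots> = (\<Sum>j=1..n. first_returns j * returns (n - j))"
  proof (rule sum.cong[OF refl])
    fix j assume "j \<in> {1..n}"
    then show "measure_pmf.prob ?R (?A j) = first_returns j * returns (n - j)"
      using prob_replicate_pmf_take_drop[of j n \<mu> first_return_word "\<lambda>ys. word_prod ys = \<one>"]
      by (simp add: first_returns_def returns_eq_prob)
  qed
  finally show ?thesis .
qed

lemma prob_avoid_identity:
  "measure_pmf.prob (replicate_pmf N \<mu>) {xs. \<forall>j\<in>{1..N}. word_prod (take j xs) \<noteq> \<one>} =
    1 - (\<Sum>j=1..N. first_returns j)"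
proof -
  let ?R = "replicate_pmf N \<mu>"
  let ?B = "\<lambda>j. {xs. length xs = N \<and> first_return_word (take j xs)}"
  let ?U = "\<Union>j\<in>{1..N}. ?B j"
  have "measure_pmf.prob ?R ?U = (\<Sum>j=1..N. measure_pmf.prob ?R (?B j))"
  proof (rule measure_pmf.finite_measure_finite_Union)
    have disjoint: "?B i \<inter> ?B j = {}" if "i \<in> {1..N}" "j \<in> {1..N}" "i < j" for i j
    proof -
      have False if xs: "length xs = N" "first_return_word (take i xs)" "first_return_word (take j xs)" for xs
      proof -
        have "i \<in> {1..<length (take j xs)}"
          using \<open>i \<in> {1..N}\<close> \<open>j \<in> {1..N}\<close> \<open>i < j\<close> xs(1) by simp
        then have "word_prod (take i (take j xs)) \<noteq> \<one>"
          using xs(3) unfolding first_return_word_def by blast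
        then show False
          using xs(2) \<open>i < j\<close> by (simp add: first_return_word_def min_def)
      qed
      then show ?thesis by blast
    qed
    show "disjoint_family_on ?B {1..N}"
      unfolding disjoint_family_on_def
    proof (intro ballI impI)
      fix i j assume "i \<in> {1..N}" "j \<in> {1..N}" "i \<noteq> j"
      then show "?B i \<inter> ?B j = {}"
        using disjoint[of i j] disjoint[of j i] by (cases i j rule: linorder_cases) blast+
    qed
  qed auto
  also have "\<dots> = (\<Sum>j=1..N. first_returns j)"
  proof (rule sum.cong[OF refl])
    fix j assume "j \<in> {1..N}"
    then have "measure_pmf.prob ?R {xs. first_return_word (take j xs)} = first_returns j"
      unfolding first_returns_def by (intro prob_replicate_pmf_take) simp
    moreover have "measure_pmf.prob ?R (?B j) = measure_pmf.prob ?R {xs. first_return_word (take j xs)}"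
      by (rule prob_cong_set_pmf) (auto dest: word_length)
    ultimately show "measure_pmf.prob ?R (?B j) = first_returns j"
      by simp
  qed
  moreover have "measure_pmf.prob ?R {xs. \<forall>j\<in>{1..N}. word_prod (take j xs) \<noteq> \<one>} =
      measure_pmf.prob ?R (UNIV - ?U)"
  proof (rule prob_cong_set_pmf)
    fix xs assume "xs \<in> set_pmf ?R"
    then have len: "length xs = N" by (rule word_length)
    have "(\<forall>j\<in>{1..N}. word_prod (take j xs) \<noteq> \<one>) \<longleftrightarrow> xs \<notin> ?U"
    proof
      assume "\<forall>j\<in>{1..N}. word_prod (take j xs) \<noteq> \<one>"
      then show "xs \<notin> ?U" by (auto simp: first_return_word_def)
    next
      assume *: "xs \<notin> ?U"
      show "\<forall>j\<in>{1..N}. word_prod (take j xs) \<noteq> \<one>"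
      proof (intro ballI notI)
        fix n assume n: "n \<in> {1..N}" "word_prod (take n xs) = \<one>"
        then obtain j where "j \<in> {1..n}" "first_return_word (take j xs)"
          using first_return_word_exists[of n xs] len by auto
        with n len have "xs \<in> ?U" by auto
        with * show False by contradiction
      qed
    qed
    then show "xs \<in> {xs. \<forall>j\<in>{1..N}. word_prod (take j xs) \<noteq> \<one>} \<longleftrightarrow> xs \<in> UNIV - ?U"
      by simp
  qed
  moreover have "measure_pmf.prob ?R (UNIV - ?U) = 1 - measure_pmf.prob ?R ?U"
    using measure_pmf.prob_compl[of ?U ?R] by simp
  ultimately show ?thesis by simp
qed

lemma first_returns_nonneg: "0 \<le> first_returns n"
  by (simp add: first_returns_def)

lemma sum_first_returns_le_1: "(\<Sum>j=1..N. first_returns j) \<le> 1"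
proof -
  have "0 \<le> 1 - (\<Sum>j=1..N. first_returns j)"
    unfolding prob_avoid_identity[symmetric] by (rule measure_nonneg)
  then show ?thesis by simp
qed

lemma summable_first_returns: "summable (\<lambda>n. first_returns (Suc n))"
proof (rule bounded_imp_summable)
  show "(\<Sum>n\<le>K. first_returns (Suc n)) \<le> 1" for K
    using sum_first_returns_le_1[of "Suc K"]
    by (simp add: atMost_atLeast0 sum.shift_bounds_cl_Suc_ivl[symmetric])
qed (rule first_returns_nonneg)

text \<open>
  Here \<open>\<Sum>n. first_returns (Suc n)\<close> is the probability of ever returning.
\<close>

lemma transient_imp_summable_returns:
  assumes "(\<Sum>n. first_returns (Suc n)) < 1"
  shows "summable returns"
proof (rule renewal_imp_summable)
  show "(\<Sum>j=1..n. first_returns j) \<le> (\<Sum>n. first_returns (Suc n))" for n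
  proof -
    have "(\<Sum>j=1..n. first_returns j) = (\<Sum>j<n. first_returns (Suc j))"
      by (rule sum.reindex_bij_witness[of _ Suc "\<lambda>j. j - 1"]) auto
    also have "\<dots> \<le> (\<Sum>n. first_returns (Suc n))"
      by (intro sum_le_suminf summable_first_returns) (auto simp: first_returns_nonneg)
    finally show ?thesis .
  qed
qed (use assms returns_renewal in \<open>simp_all add: first_returns_nonneg u_le_1 u_nonneg\<close>)

end

section \<open>The steps of the walk as a random word\<close>

lemma pmf_replicate_pmf:
  "length xs = n \<Longrightarrow> pmf (replicate_pmf n p) xs = (\<Prod>i<n. pmf p (xs ! i))"
proof (induction n arbitrary: xs)
  case (Suc n)
  then obtain y ys where xs: "xs = y # ys" "length ys = n"
    by (auto simp: length_Suc_conv)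
  have "replicate_pmf (Suc n) p = map_pmf (\<lambda>(y, ys). y # ys) (pair_pmf p (replicate_pmf n p))"
    by (simp add: pair_pmf_def map_bind_pmf)
  moreover have "inj (\<lambda>(y, ys). y # ys)"
    by (auto intro!: injI)
  ultimately have "pmf (replicate_pmf (Suc n) p) xs = pmf (pair_pmf p (replicate_pmf n p)) (y, ys)"
    using pmf_map_inj'[of "\<lambda>(y, ys). y # ys" "pair_pmf p (replicate_pmf n p)" "(y, ys)"] xs by simp
  then show ?case
    using Suc.IH[OF xs(2)] xs by (simp add: pmf_pair prod.lessThan_Suc_shift del: prod.lessThan_Suc)
qed simp

locale symmetric_cayley_walk = cayley_random_walk G M s gen \<alpha> X
  for G :: "('a, 'b) monoid_scheme" (structure) and M :: "'w measure"
    and s :: nat and gen :: "nat \<Rightarrow> 'a" and \<alpha> :: "nat \<Rightarrow> real" and X :: "nat \<Rightarrow> 'w \<Rightarrow> 'a" +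
  assumes symmetric: "\<And>i. i \<in> {1..s} \<Longrightarrow> \<alpha> i = \<alpha> (s + i)"
begin

definition gens :: "'a set" where
  "gens = gen ` {1..s} \<union> (\<lambda>i. inv (gen i)) ` {1..s}"

lemma finite_gens: "finite gens"
  by (simp add: gens_def)

lemma gens_closed: "gens \<subseteq> carrier G"
  using gen_closed by (auto simp: gens_def simp del: atLeastAtMost_iff)

lemma inv_gens: "x \<in> gens \<Longrightarrow> inv x \<in> gens"
  using gen_closed by (auto simp: gens_def simp del: atLeastAtMost_iff)

text \<open>
  Countability makes the \<open>\<sigma>\<close>-algebra on words discrete, so that every set of words is an event.
\<close>

lemma countable_carrier: "countable (carrier G)"
proof -
  have "carrier G \<subseteq> word_prod ` lists gens"
  proof
    fix x assume "x \<in> carrier G"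
    then have "x \<in> generate G gens"
      using gen_generates by (simp add: gens_def)
    then show "x \<in> word_prod ` lists gens"
    proof induction
      case one
      show ?case by (rule image_eqI[of _ _ "[]"]) (auto simp: word_prod_def)
    next
      case (incl h)
      then show ?case
        using gens_closed by (intro image_eqI[of _ _ "[h]"]) (auto simp: word_prod_def)
    next
      case (inv h)
      then show ?case
        using gens_closed inv_gens[of h]
        by (intro image_eqI[of _ _ "[inv h]"]) (auto simp: word_prod_def)
    next
      case (eng a b)
      then obtain xs ys where "xs \<in> lists gens" "ys \<in> lists gens" "a = word_prod xs" "b = word_prod ys"
        by auto
      then show ?case
        using word_prod_append[of xs ys] gens_closed
        by (intro image_eqI[of _ _ "xs @ ys"]) (auto simp: lists_eq_set)
    qed
  qed
  then show ?thesis
    by (rule countable_subset) (simp add: countable_finite finite_gens)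
qed

abbreviation weight :: "'a \<Rightarrow> real" where
  "weight \<equiv> step_weight G s gen \<alpha>"

lemma weight_eq_0: "x \<notin> gens \<Longrightarrow> weight x = 0"
proof -
  assume "x \<notin> gens"
  then have "{i\<in>{1..s}. gen i = x} = {}" "{i\<in>{1..s}. inv (gen i) = x} = {}"
    by (auto simp: gens_def)
  then show ?thesis
    unfolding step_weight_def by (simp only: sum.empty)
qed

lemma weight_ge_0: "0 \<le> weight x"
  unfolding step_weight_def by (intro add_nonneg_nonneg sum_nonneg weight_nonneg) simp_all

lemma sum_weight: "sum weight gens = 1"
proof -
  have "sum weight gens = (\<Sum>x\<in>gens. \<Sum>i\<in>{i\<in>{1..s}. gen i = x}. \<alpha> i)
      + (\<Sum>x\<in>gens. \<Sum>i\<in>{i\<in>{1..s}. inv (gen i) = x}. \<alpha> (s + i))"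
    by (simp add: step_weight_def sum.distrib)
  also have "\<dots> = (\<Sum>i\<in>{1..s}. \<alpha> i) + (\<Sum>i\<in>{1..s}. \<alpha> (s + i))"
    using finite_gens by (intro arg_cong2[where f = "(+)"] sum.group) (auto simp: gens_def)
  also have "\<dots> = (\<Sum>i = 1..2 * s. \<alpha> i)"
    using sum.ub_add_nat[of 1 s \<alpha> s] sum.shift_bounds_cl_nat_ivl[of \<alpha> 1 s s]
    by (simp add: mult_2 add.commute)
  also have "\<dots> = 1"
    by (rule weight_sum)
  finally show ?thesis .
qed

lemma weight_inv:
  assumes "x \<in> carrier G"
  shows "weight (inv x) = weight x"
proof -
  have "{i\<in>{1..s}. gen i = inv x} = {i\<in>{1..s}. inv (gen i) = x}"
    "{i\<in>{1..s}. inv (gen i) = inv x} = {i\<in>{1..s}. gen i = x}"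
    using assms gen_closed by (auto dest: inj_onD[OF inv_inj])
  moreover have "(\<Sum>i\<in>{i\<in>{1..s}. P i}. \<alpha> (s + i)) = (\<Sum>i\<in>{i\<in>{1..s}. P i}. \<alpha> i)" for P
    by (intro sum.cong refl symmetric[THEN sym]) simp
  ultimately show ?thesis
    by (simp only: step_weight_def add.commute)
qed

definition step_law :: "'a pmf" where
  "step_law = embed_pmf weight"

lemma pmf_step_law: "pmf step_law x = weight x"
  unfolding step_law_def
proof (rule pmf_embed_pmf)
  have "(\<integral>\<^sup>+ x. ennreal (weight x) \<partial>count_space UNIV) = (\<Sum>x\<in>gens. ennreal (weight x))"
    using finite_gens weight_eq_0 by (intro nn_integral_count_space') auto
  then show "(\<integral>\<^sup>+ x. ennreal (weight x) \<partial>count_space UNIV) = 1"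
    using sum_weight weight_ge_0 by (simp add: sum_ennreal)
qed (rule weight_ge_0)

lemma set_step_law: "set_pmf step_law \<subseteq> gens"
proof
  fix x assume "x \<in> set_pmf step_law"
  then have "weight x \<noteq> 0"
    by (simp add: set_pmf_iff pmf_step_law)
  then show "x \<in> gens"
    using weight_eq_0 by blast
qed

sublocale symmetric_step_law G step_law
proof
  show "finite (set_pmf step_law)"
    using set_step_law finite_gens by (rule finite_subset)
  show closed: "set_pmf step_law \<subseteq> carrier G"
    using set_step_law gens_closed by (rule order_trans)
  show "map_pmf (\<lambda>x. inv x) step_law = step_law"
  proof (rule pmf_eqI)
    fix y
    show "pmf (map_pmf (\<lambda>x. inv x) step_law) y = pmf step_law y"
    proof (cases "y \<in> carrier G")
      case True
      have "pmf (map_pmf (\<lambda>x. inv x) step_law) y = measure_pmf.prob step_law {inv y}"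
        unfolding pmf_map using True closed
        by (intro prob_cong_set_pmf) auto
      then show ?thesis
        using True by (simp add: measure_pmf_single pmf_step_law weight_inv)
    next
      case False
      then have "pmf (map_pmf (\<lambda>x. inv x) step_law) y = 0" "pmf step_law y = 0"
        unfolding pmf_eq_0_set_pmf using closed by auto
      then show ?thesis by simp
    qed
  qed
qed

text \<open>
  The steps with indices \<open>k + 1, ..., k + n\<close>. All events about the walk are expressed through blocks,
  since their joint law is an explicit discrete distribution on words that does not depend on \<open>k\<close>.
\<close>

definition block :: "nat \<Rightarrow> nat \<Rightarrow> 'w \<Rightarrow> 'a list" where
  "block k n \<omega> = map (\<lambda>i. X (k + i) \<omega>) [1..<Suc n]"

lemma length_block: "length (block k n \<omega>) = n"
  by (simp add: block_def)

lemma nth_block: "i < n \<Longrightarrow> block k n \<omega> ! i = X (k + i + 1) \<omega>"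
  by (simp add: block_def del: upt_Suc)

lemma take_block: "j \<le> n \<Longrightarrow> take j (block k n \<omega>) = block k j \<omega>"
  by (rule nth_equalityI) (simp_all add: length_block nth_block)

lemma step_measurable: "1 \<le> i \<Longrightarrow> X i \<in> measurable M (count_space (carrier G))"
  using steps_indep by (simp add: indep_vars_def)

lemma step_closed: "1 \<le> i \<Longrightarrow> \<omega> \<in> space M \<Longrightarrow> X i \<omega> \<in> carrier G"
  using measurable_space[OF step_measurable, of i \<omega>] by simp

lemma block_closed: "\<omega> \<in> space M \<Longrightarrow> set (block k n \<omega>) \<subseteq> carrier G"
  by (auto simp: block_def intro!: step_closed simp del: upt_Suc)

lemma block_eq_iff:
  assumes "length xs = n"
  shows "block k n \<omega> = xs \<longleftrightarrow> (\<forall>i<n. X (k + i + 1) \<omega> = xs ! i)"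
  using assms nth_equalityI[of "block k n \<omega>" xs] by (metis length_block nth_block)

lemma block_singleton_event:
  assumes "length xs = n"
  shows "{\<omega>\<in>space M. block k n \<omega> = xs} \<in> events"
proof -
  have "{\<omega>\<in>space M. X (k + i + 1) \<omega> = xs ! i} \<in> events" for i
  proof -
    have "X (k + i + 1) -` ({xs ! i} \<inter> carrier G) \<inter> space M \<in> events"
      by (rule measurable_sets[OF step_measurable]) auto
    also have "X (k + i + 1) -` ({xs ! i} \<inter> carrier G) \<inter> space M = {\<omega>\<in>space M. X (k + i + 1) \<omega> = xs ! i}"
      using step_closed[of "k + i + 1"] by auto
    finally show ?thesis .
  qed
  then have "{\<omega>\<in>space M. \<forall>i\<in>{..<n}. X (k + i + 1) \<omega> = xs ! i} \<in> events"
    by (intro sets.sets_Collect_finite_All) auto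
  then show ?thesis
    unfolding block_eq_iff[OF assms] by (simp only: Ball_def lessThan_iff)
qed

lemma block_measurable: "block k n \<in> measurable M (count_space (lists (carrier G)))"
proof -
  have "block k n -` {xs} \<inter> space M \<in> events" for xs
  proof (cases "length xs = n")
    case True
    then show ?thesis
      using block_singleton_event[OF True, of k] by (simp add: vimage_def Int_def conj_commute)
  next
    case False
    then have "block k n -` {xs} \<inter> space M = {}"
      by (auto simp: length_block)
    then show ?thesis by simp
  qed
  then show ?thesis
    using block_closed countable_carrier
    by (subst measurable_count_space_eq_countable) (auto simp: in_lists_conv_set subset_iff)
qed

lemma block_event: "{\<omega>\<in>space M. Q (block k n \<omega>)} \<in> events"
proof -
  have "block k n -` ({xs. Q xs} \<inter> lists (carrier G)) \<inter> space M \<in> events"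
    by (rule measurable_sets[OF block_measurable]) auto
  also have "block k n -` ({xs. Q xs} \<inter> lists (carrier G)) \<inter> space M = {\<omega>\<in>space M. Q (block k n \<omega>)}"
    using block_closed by (auto simp: in_lists_conv_set subset_iff)
  finally show ?thesis .
qed

lemma prob_block_singleton:
  assumes xs: "length xs = n" "set xs \<subseteq> carrier G"
  shows "prob {\<omega>\<in>space M. block k n \<omega> = xs} = pmf (replicate_pmf n step_law) xs"
proof (cases "n = 0")
  case True
  with xs(1) show ?thesis
    by (simp add: block_def prob_space)
next
  case False
  let ?J = "{k + 1..k + n}" and ?A = "\<lambda>i. {xs ! (i - k - 1)}"
  have J: "?J = (\<lambda>i. k + i + 1) ` {..<n}"
  proof (intro equalityI subsetI)
    fix i assume "i \<in> ?J"
    then have "i = k + (i - k - 1) + 1" "i - k - 1 \<in> {..<n}" by auto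
    then show "i \<in> (\<lambda>i. k + i + 1) ` {..<n}" by (rule image_eqI)
  qed auto
  have "{\<omega>\<in>space M. block k n \<omega> = xs} = {\<omega>\<in>space M. \<forall>i\<in>?J. X i \<omega> = xs ! (i - k - 1)}"
    unfolding block_eq_iff[OF xs(1)] J by (simp add: lessThan_def)
  also have "\<dots> = (\<Inter>i\<in>?J. X i -` ?A i \<inter> space M)"
    using False by auto
  finally have eq: "{\<omega>\<in>space M. block k n \<omega> = xs} = (\<Inter>i\<in>?J. X i -` ?A i \<inter> space M)" .
  have "xs ! (i - k - 1) \<in> carrier G" if "i \<in> ?J" for i
    using that xs nth_mem[of "i - k - 1" xs] by auto
  then have "prob {\<omega>\<in>space M. block k n \<omega> = xs} = (\<Prod>i\<in>?J. prob (X i -` ?A i \<inter> space M))"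
    unfolding eq using False by (intro indep_varsD[OF steps_indep]) auto
  also have "\<dots> = (\<Prod>i<n. prob (X (k + i + 1) -` {xs ! i} \<inter> space M))"
    by (rule prod.reindex_bij_witness[of _ "\<lambda>i. k + i + 1" "\<lambda>i. i - k - 1"]) auto
  also have "\<dots> = (\<Prod>i<n. pmf step_law (xs ! i))"
  proof (rule prod.cong[OF refl])
    fix i assume "i \<in> {..<n}"
    then have "xs ! i \<in> carrier G"
      using xs nth_mem[of i xs] by auto
    then have "prob {\<omega>\<in>space M. X (k + i + 1) \<omega> = xs ! i} = weight (xs ! i)"
      by (intro steps_law) auto
    then show "prob (X (k + i + 1) -` {xs ! i} \<inter> space M) = pmf step_law (xs ! i)"
      by (simp add: pmf_step_law vimage_def Int_def conj_commute)
  qed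
  finally show ?thesis
    by (simp add: pmf_replicate_pmf[OF xs(1)])
qed

text \<open>
  The word distribution is carried by finitely many words, on which the point masses agree. This gives
  one inequality, and its application to the complement of \<open>Q\<close> gives the other.
\<close>

lemma prob_block:
  "prob {\<omega>\<in>space M. Q (block k n \<omega>)} = measure_pmf.prob (replicate_pmf n step_law) {xs. Q xs}"
proof -
  let ?R = "replicate_pmf n step_law"
  have finite: "finite (set_pmf ?R)"
    using finite_lists_length_eq[OF finite_support]
    by (simp add: set_replicate_pmf lists_eq_set conj_commute)
  have le: "measure_pmf.prob ?R {xs. Q xs} \<le> prob {\<omega>\<in>space M. Q (block k n \<omega>)}" for Q
  proof -
    let ?A = "{xs. Q xs} \<inter> set_pmf ?R"
    have "measure_pmf.prob ?R {xs. Q xs} = (\<Sum>xs\<in>?A. pmf ?R xs)"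
      using finite by (simp add: measure_Int_set_pmf flip: measure_measure_pmf_finite)
    also have "\<dots> = (\<Sum>xs\<in>?A. prob {\<omega>\<in>space M. block k n \<omega> = xs})"
      by (intro sum.cong refl prob_block_singleton[symmetric]) (auto dest: word_closed word_length)
    also have "\<dots> = prob (\<Union>xs\<in>?A. {\<omega>\<in>space M. block k n \<omega> = xs})"
      using finite
      by (intro finite_measure_finite_Union[symmetric])
        (auto simp: disjoint_family_on_def dest: word_length intro: block_singleton_event)
    also have "\<dots> \<le> prob {\<omega>\<in>space M. Q (block k n \<omega>)}"
      by (intro finite_measure_mono block_event) auto
    finally show ?thesis .
  qed
  have "prob {\<omega>\<in>space M. \<not> Q (block k n \<omega>)} = 1 - prob {\<omega>\<in>space M. Q (block k n \<omega>)}"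
    by (rule prob_neg[OF block_event])
  moreover have "measure_pmf.prob ?R {xs. \<not> Q xs} = 1 - measure_pmf.prob ?R {xs. Q xs}"
    using measure_pmf.prob_compl[of "{xs. Q xs}" ?R] by (simp add: set_diff_eq)
  ultimately show ?thesis
    using le[of Q] le[of "\<lambda>xs. \<not> Q xs"] by linarith
qed

lemma walk_eq_block: "walk G X n \<omega> = word_prod (block 0 n \<omega>)"
proof (induction n)
  case (Suc n)
  have "block 0 (Suc n) \<omega> = block 0 n \<omega> @ [X (Suc n) \<omega>]"
    by (simp add: block_def)
  with Suc show ?case
    by (simp add: word_prod_snoc)
qed (simp add: block_def word_prod_Nil)

lemma walk_closed: "\<omega> \<in> space M \<Longrightarrow> walk G X n \<omega> \<in> carrier G"
  unfolding walk_eq_block by (intro word_prod_closed block_closed)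

lemma walk_add:
  assumes "\<omega> \<in> space M"
  shows "walk G X (k + j) \<omega> = walk G X k \<omega> \<otimes> word_prod (block k j \<omega>)"
proof -
  have "block 0 (k + j) \<omega> = block 0 k \<omega> @ block k j \<omega>"
    by (rule nth_equalityI) (auto simp: length_block nth_block nth_append)
  then show ?thesis
    using assms by (simp add: walk_eq_block word_prod_append block_closed)
qed

lemma return_prob_eq_returns: "return_prob G M X n = returns n"
  unfolding return_prob_def walk_eq_block returns_eq_prob
  by (rule prob_block[of "\<lambda>xs. word_prod xs = \<one>"])

end

section \<open>Concentration of the number of fresh positions\<close>

context symmetric_cayley_walk
begin

abbreviation trajectory :: "'w \<Rightarrow> nat \<Rightarrow> 'a" where
  "trajectory \<omega> \<equiv> \<lambda>k. walk G X k \<omega>"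

text \<open>
  The probability of not returning within \<open>N\<close> steps, in terms of the first return probabilities.
\<close>

definition escape :: "nat \<Rightarrow> real" where
  "escape N = 1 - (\<Sum>j=1..N. first_returns j)"

definition avoids_identity :: "nat \<Rightarrow> 'a list \<Rightarrow> bool" where
  "avoids_identity N xs \<longleftrightarrow> (\<forall>j\<in>{1..N}. word_prod (take j xs) \<noteq> \<one>)"

lemma fresh_iff_block:
  assumes "\<omega> \<in> space M"
  shows "fresh N (trajectory \<omega>) k \<longleftrightarrow> avoids_identity N (block k N \<omega>)"
proof -
  have "trajectory \<omega> (k + j) = trajectory \<omega> k \<longleftrightarrow> word_prod (block k j \<omega>) = \<one>" for j
    unfolding walk_add[OF assms]
    by (intro l_cancel_one walk_closed word_prod_closed block_closed assms)
  then show ?thesis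
    by (simp add: fresh_def avoids_identity_def take_block)
qed

lemma prob_fresh: "prob {\<omega>\<in>space M. avoids_identity N (block k N \<omega>)} = escape N"
  unfolding escape_def prob_avoid_identity[symmetric] prob_block[of "avoids_identity N"]
  by (rule arg_cong[where f = "measure_pmf.prob _"]) (auto simp: avoids_identity_def)

definition fresh_at :: "nat \<Rightarrow> nat \<Rightarrow> 'w \<Rightarrow> real" where
  "fresh_at N k \<omega> = of_bool (avoids_identity N (block k N \<omega>))"

lemma fresh_at_bounds: "0 \<le> fresh_at N k \<omega>" "fresh_at N k \<omega> \<le> 1"
  by (simp_all add: fresh_at_def)

lemma fresh_at_measurable: "fresh_at N k \<in> borel_measurable M"
  unfolding fresh_at_def
  by (rule measurable_compose[OF block_measurable, of "\<lambda>xs. of_bool (avoids_identity N xs)"]) simp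

lemma expectation_fresh_at: "expectation (fresh_at N k) = escape N"
proof -
  have "expectation (fresh_at N k) = expectation (indicator {\<omega>\<in>space M. avoids_identity N (block k N \<omega>)})"
    by (intro Bochner_Integration.integral_cong) (auto simp: fresh_at_def)
  also have "\<dots> = prob {\<omega>\<in>space M. avoids_identity N (block k N \<omega>)}"
    using block_event[of "avoids_identity N" k N] by (simp add: Int_absorb1)
  finally show ?thesis
    by (simp add: prob_fresh)
qed

lemma escape_bounds: "0 \<le> escape N" "escape N \<le> 1"
  unfolding prob_fresh[of N 0, symmetric] by (rule measure_nonneg, rule prob_le_1)

lemma card_fresh_eq_sum:
  assumes "\<omega> \<in> space M"
  shows "real (card {k\<in>{..<n}. fresh N (trajectory \<omega>) k}) = (\<Sum>k<n. fresh_at N k \<omega>)"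
proof -
  have "(\<Sum>k<n. fresh_at N k \<omega>) = (\<Sum>k<n. of_bool (fresh N (trajectory \<omega>) k))"
    by (intro sum.cong refl) (simp add: fresh_at_def fresh_iff_block[OF assms])
  also have "\<dots> = (\<Sum>k\<in>{k\<in>{..<n}. fresh N (trajectory \<omega>) k}. 1)"
    by (intro sum.mono_neutral_cong_right) auto
  finally show ?thesis by simp
qed

text \<open>
  Along a residue class modulo \<open>N\<close> the windows of length \<open>N\<close> are disjoint blocks of steps.
\<close>

lemma indep_fresh_at: "indep_vars (\<lambda>_. borel) (\<lambda>i. fresh_at N (r + i * N)) {..<L}"
proof -
  let ?K = "\<lambda>i. {r + i * N + 1..r + i * N + N}"
  let ?Y = "\<lambda>i f. of_bool (avoids_identity N (map (\<lambda>j. f (r + i * N + j)) [1..<Suc N])) :: real"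
  have disjoint: "?K i \<inter> ?K j = {}" if "i < j" for i j
  proof -
    have "i * N + N \<le> j * N"
      using that mult_le_mono1[of "Suc i" j N] by simp
    then show ?thesis by auto
  qed
  have "disjoint_family_on ?K {..<L}"
    unfolding disjoint_family_on_def
  proof (intro ballI impI)
    fix i j :: nat assume "i \<noteq> j"
    then show "?K i \<inter> ?K j = {}"
      using disjoint[of i j] disjoint[of j i] by (cases i j rule: linorder_cases) blast+
  qed
  then have indep: "indep_vars (\<lambda>i. PiM (?K i) (\<lambda>_. count_space (carrier G)))
      (\<lambda>i \<omega>. restrict (\<lambda>j. X j \<omega>) (?K i)) {..<L}"
    by (intro indep_vars_restrict[OF steps_indep]) auto
  have "indep_vars (\<lambda>_. borel) (\<lambda>i \<omega>. ?Y i (restrict (\<lambda>j. X j \<omega>) (?K i))) {..<L}"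
  proof (rule indep_vars_compose2[OF indep])
    fix i
    have "PiM (?K i) (\<lambda>_. count_space (carrier G)) = count_space (PiE (?K i) (\<lambda>_. carrier G))"
      by (rule count_space_PiM_finite) (auto simp: countable_carrier)
    then show "?Y i \<in> measurable (PiM (?K i) (\<lambda>_. count_space (carrier G))) borel"
      by simp
  qed
  also have "(\<lambda>i \<omega>. ?Y i (restrict (\<lambda>j. X j \<omega>) (?K i))) = (\<lambda>i. fresh_at N (r + i * N))"
  proof (intro ext)
    fix i \<omega>
    have "map (\<lambda>j. restrict (\<lambda>j. X j \<omega>) (?K i) (r + i * N + j)) [1..<Suc N] = block (r + i * N) N \<omega>"
      unfolding block_def by (rule map_cong) auto
    then show "?Y i (restrict (\<lambda>j. X j \<omega>) (?K i)) = fresh_at N (r + i * N) \<omega>"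
      by (simp only: fresh_at_def)
  qed
  finally show ?thesis .
qed

lemma fresh_at_residue_concentration:
  assumes "0 \<le> \<epsilon>" "1 \<le> L"
  shows "prob {\<omega>\<in>space M. \<bar>(\<Sum>i<L. fresh_at N (r + i * N) \<omega>) - real L * escape N\<bar> \<ge> \<epsilon> * real L}
    \<le> 2 * exp (- 2 * \<epsilon>\<^sup>2 * real L)"
proof -
  interpret Hoeffding_ineq M "{..<L}" "\<lambda>i. fresh_at N (r + i * N)" "\<lambda>_. 0" "\<lambda>_. 1" "real L * escape N"
    by unfold_locales (simp_all add: indep_fresh_at fresh_at_bounds expectation_fresh_at)
  have "- 2 * (\<epsilon> * real L)\<^sup>2 / real L = - 2 * \<epsilon>\<^sup>2 * real L"
    using assms by (simp add: power2_eq_square)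
  then show ?thesis
    using Hoeffding_ineq_abs_ge[of "\<epsilon> * real L"] assms by simp
qed

lemma fresh_at_measurable_sum:
  "(\<lambda>\<omega>. \<Sum>k\<in>A. fresh_at N (f k) \<omega>) \<in> borel_measurable M"
  by (intro borel_measurable_sum fresh_at_measurable)

text \<open>
  The positions below \<open>N * (n div N)\<close> split into the residue classes modulo \<open>N\<close>. If the average over
  each class deviates by less than \<open>\<epsilon> / 2\<close>, then so does the overall average, up to the at most \<open>N\<close>
  remaining positions.
\<close>

lemma fresh_concentration:
  assumes "0 < \<epsilon>" "1 \<le> N" "N \<le> n" "real N \<le> \<epsilon> / 2 * real n"
  shows "prob {\<omega>\<in>space M. \<bar>(\<Sum>k<n. fresh_at N k \<omega>) - real n * escape N\<bar> \<ge> \<epsilon> * real n}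
    \<le> 2 * real N * exp (- \<epsilon>\<^sup>2 / 2 * real (n div N))"
proof -
  define L where "L = n div N"
  have L: "1 \<le> L" "L * N \<le> n" "n < L * N + N"
    using assms by (auto simp: L_def div_greater_zero_iff Suc_le_eq dividend_less_div_times add.commute)
  let ?B = "\<lambda>r. {\<omega>\<in>space M. \<bar>(\<Sum>i<L. fresh_at N (r + i * N) \<omega>) - real L * escape N\<bar> \<ge> \<epsilon> / 2 * real L}"
  have B: "?B r \<in> events" for r
    using fresh_at_measurable_sum[where f = "\<lambda>i. r + i * N" and A = "{..<L}"] by measurable
  have "{\<omega>\<in>space M. \<bar>(\<Sum>k<n. fresh_at N k \<omega>) - real n * escape N\<bar> \<ge> \<epsilon> * real n} \<subseteq> (\<Union>r\<in>{..<N}. ?B r)"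
  proof (rule subsetI, rule ccontr)
    fix \<omega>
    assume \<omega>: "\<omega> \<in> {\<omega>\<in>space M. \<bar>(\<Sum>k<n. fresh_at N k \<omega>) - real n * escape N\<bar> \<ge> \<epsilon> * real n}"
      and "\<omega> \<notin> (\<Union>r\<in>{..<N}. ?B r)"
    then have small: "\<bar>(\<Sum>i<L. fresh_at N (r + i * N) \<omega>) - real L * escape N\<bar> < \<epsilon> / 2 * real L" if "r < N" for r
      using that by (auto simp: not_le)
    define z where "z k = fresh_at N k \<omega> - escape N" for k
    have "sum z {..<L * N} = (\<Sum>i<L. \<Sum>r<N. z (r + i * N))"
      unfolding sum.nat_group[symmetric]
    proof (rule sum.cong[OF refl])
      fix i
      show "sum z {i * N..<i * N + N} = (\<Sum>r<N. z (r + i * N))"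
        using sum.shift_bounds_nat_ivl[of z 0 "i * N" N] by (simp add: lessThan_atLeast0 add.commute)
    qed
    also have "\<dots> = (\<Sum>r<N. \<Sum>i<L. z (r + i * N))"
      by (rule sum.swap)
    finally have "\<bar>sum z {..<L * N}\<bar> \<le> (\<Sum>r<N. \<bar>\<Sum>i<L. z (r + i * N)\<bar>)"
      by simp
    also have "\<dots> < (\<Sum>r<N. \<epsilon> / 2 * real L)"
      using small assms(2) by (intro sum_strict_mono) (auto simp: z_def sum_subtractf lessThan_empty_iff)
    also have "\<dots> = \<epsilon> / 2 * real (L * N)"
      by simp
    also have "\<dots> \<le> \<epsilon> / 2 * real n"
      using L assms by (intro mult_left_mono of_nat_mono) auto
    finally have main: "\<bar>sum z {..<L * N}\<bar> < \<epsilon> / 2 * real n" .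
    have "\<bar>z k\<bar> \<le> 1" for k
      using fresh_at_bounds[of N k \<omega>] escape_bounds[of N] by (simp add: z_def)
    then have "\<bar>sum z {L * N..<n}\<bar> \<le> (\<Sum>k\<in>{L * N..<n}. 1)"
      by (intro order_trans[OF sum_abs] sum_mono)
    also have "\<dots> = real (n - L * N)"
      by (simp only: sum_constant card_atLeastLessThan mult_1_right)
    also have "\<dots> \<le> real N"
      using L by (intro of_nat_mono) linarith
    finally have rest: "\<bar>sum z {L * N..<n}\<bar> \<le> \<epsilon> / 2 * real n"
      using assms by simp
    have "sum z {..<n} = sum z {..<L * N} + sum z {L * N..<n}"
      using L sum.atLeastLessThan_concat[of 0 "L * N" n z] by (simp add: lessThan_atLeast0)
    then have "\<bar>sum z {..<n}\<bar> < \<epsilon> * real n"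
      using main rest by linarith
    then show False
      using \<omega> by (simp add: z_def sum_subtractf)
  qed
  then have "prob {\<omega>\<in>space M. \<bar>(\<Sum>k<n. fresh_at N k \<omega>) - real n * escape N\<bar> \<ge> \<epsilon> * real n}
      \<le> prob (\<Union>r\<in>{..<N}. ?B r)"
    using B by (intro finite_measure_mono) auto
  also have "\<dots> \<le> (\<Sum>r<N. prob (?B r))"
    using B by (intro finite_measure_subadditive_finite) auto
  also have "\<dots> \<le> (\<Sum>r<N. 2 * exp (- 2 * (\<epsilon> / 2)\<^sup>2 * real L))"
    using assms L by (intro sum_mono fresh_at_residue_concentration) auto
  also have "\<dots> = 2 * real N * exp (- \<epsilon>\<^sup>2 / 2 * real (n div N))"
    by (simp add: L_def power2_eq_square)
  finally show ?thesis .
qed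

section \<open>Long loops in a bridge\<close>

text \<open>
  The return to the identity at time \<open>n\<close> is part of the event, which makes its probability a product
  of return probabilities. Division by \<open>returns n\<close> turns it into a probability for the bridge.
\<close>

definition loop_event :: "nat \<Rightarrow> nat \<times> nat \<Rightarrow> 'w set" where
  "loop_event n = (\<lambda>(k, j). {\<omega>\<in>space M. trajectory \<omega> (k + j) = trajectory \<omega> k \<and> trajectory \<omega> n = \<one>})"

lemma loop_event:
  assumes "k + j \<le> n"
  shows "loop_event n (k, j) \<in> events" "prob (loop_event n (k, j)) = returns j * returns (n - j)"
proof -
  let ?Q = "\<lambda>xs. word_prod (take (k + j) xs) = word_prod (take k xs) \<and> word_prod xs = \<one>"
  have eq: "loop_event n (k, j) = {\<omega>\<in>space M. ?Q (block 0 n \<omega>)}"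
    using assms by (simp add: loop_event_def walk_eq_block take_block)
  show "loop_event n (k, j) \<in> events"
    unfolding eq by (rule block_event[of ?Q])
  show "prob (loop_event n (k, j)) = returns j * returns (n - j)"
    unfolding eq prob_block[of ?Q] by (rule prob_loop_in_bridge[OF assms])
qed

definition loop_positions :: "nat \<Rightarrow> nat \<Rightarrow> (nat \<times> nat) set" where
  "loop_positions N n = {(k, j). N < j \<and> k + j < n}"

lemma finite_loop_positions: "finite (loop_positions N n)"
  by (rule finite_subset[of _ "{..<n} \<times> {..<n}"]) (auto simp: loop_positions_def)

definition loop_count :: "nat \<Rightarrow> nat \<Rightarrow> 'w \<Rightarrow> real" where
  "loop_count N n \<omega> = (\<Sum>p\<in>loop_positions N n. indicator (loop_event n p) \<omega>)"

lemma loop_event_positions: "p \<in> loop_positions N n \<Longrightarrow> loop_event n p \<in> events"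
  using loop_event(1) by (auto simp: loop_positions_def)

lemma loop_count_measurable: "loop_count N n \<in> borel_measurable M"
  unfolding loop_count_def
  by (intro borel_measurable_sum borel_measurable_indicator loop_event_positions)

lemma loop_count_nonneg: "0 \<le> loop_count N n \<omega>"
  by (simp add: loop_count_def sum_nonneg)

lemma card_long_loops_bridge:
  assumes "\<omega> \<in> space M" "trajectory \<omega> n = \<one>"
  shows "real (card (long_loops N n (trajectory \<omega>))) = loop_count N n \<omega>"
proof -
  have "loop_count N n \<omega> = (\<Sum>p\<in>long_loops N n (trajectory \<omega>). 1)"
    unfolding loop_count_def using finite_loop_positions assms
    by (intro sum.mono_neutral_cong_right)
      (auto simp: loop_positions_def long_loops_def loop_event_def indicator_def)
  then show ?thesis by simp
qed

text \<open>
  Markov's inequality. There are \<open>n - j\<close> possible starting times for a loop of length \<open>j\<close>, and all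
  of them have the same probability.
\<close>

lemma prob_many_long_loops:
  assumes "0 < c"
  shows "prob {\<omega>\<in>space M. loop_count N n \<omega> \<ge> c}
    \<le> (\<Sum>j\<in>{N<..<n}. real (n - j) * (returns j * returns (n - j))) / c"
proof -
  have int: "integrable M (\<lambda>\<omega>. indicator (loop_event n p) \<omega> :: real)" if "p \<in> loop_positions N n" for p
    by (rule integrable_real_indicator[OF loop_event_positions[OF that]]) (simp add: emeasure_eq_measure)
  have "integrable M (loop_count N n)"
    unfolding loop_count_def by (intro Bochner_Integration.integrable_sum int)
  then have "prob {\<omega>\<in>space M. loop_count N n \<omega> \<ge> c} \<le> expectation (loop_count N n) / c"
    using assms
    by (intro integral_Markov_inequality_measure[where A = "{}"]) (auto simp: loop_count_nonneg)
  also have "expectation (loop_count N n) = (\<Sum>p\<in>loop_positions N n. prob (loop_event n p))"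
    unfolding loop_count_def using loop_event_positions
    by (subst Bochner_Integration.integral_sum[OF int]) (auto intro!: sum.cong)
  also have "\<dots> = (\<Sum>(k, j)\<in>loop_positions N n. returns j * returns (n - j))"
    using loop_event(2) by (intro sum.cong refl) (auto simp: loop_positions_def)
  also have "\<dots> = (\<Sum>(j, k)\<in>(SIGMA j:{N<..<n}. {..<n - j}). returns j * returns (n - j))"
    by (rule sum.reindex_bij_witness[of _ "\<lambda>(j, k). (k, j)" "\<lambda>(k, j). (j, k)"])
      (auto simp: loop_positions_def)
  also have "\<dots> = (\<Sum>j\<in>{N<..<n}. real (n - j) * (returns j * returns (n - j)))"
    by (subst sum.Sigma[symmetric]) auto
  finally show ?thesis .
qed

section \<open>The range of a bridge\<close>

lemma first_return_prob_eq: "first_return_prob G M X n = first_returns n"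
proof -
  have "first_return_prob G M X n = prob {\<omega>\<in>space M. first_return_word (block 0 n \<omega>)}"
    unfolding first_return_prob_def
  proof (intro arg_cong[where f = prob] Collect_cong conj_cong refl)
    fix \<omega>
    have "(\<forall>k. 1 \<le> k \<and> k \<le> n - 1 \<longrightarrow> trajectory \<omega> k \<noteq> \<one>) \<longleftrightarrow>
        (\<forall>k\<in>{1..<n}. word_prod (take k (block 0 n \<omega>)) \<noteq> \<one>)"
      by (auto simp: walk_eq_block take_block)
    then show "(\<forall>k. 1 \<le> k \<and> k \<le> n - 1 \<longrightarrow> trajectory \<omega> k \<noteq> \<one>) \<and> trajectory \<omega> n = \<one> \<longleftrightarrow>
        first_return_word (block 0 n \<omega>)"
      by (simp add: first_return_word_def length_block walk_eq_block)
  qed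
  also have "\<dots> = first_returns n"
    unfolding first_returns_def by (rule prob_block[of first_return_word])
  finally show ?thesis .
qed

abbreviation F :: real where
  "F \<equiv> ever_return_prob G M X"

lemma F_eq: "F = (\<Sum>n. first_returns (Suc n))"
  by (simp add: ever_return_prob_def first_return_prob_eq)

lemma escape_tendsto: "escape \<longlonglongrightarrow> 1 - F"
proof -
  have "(\<Sum>j=1..N. first_returns j) = (\<Sum>j<N. first_returns (Suc j))" for N
    by (rule sum.reindex_bij_witness[of _ Suc "\<lambda>j. j - 1"]) auto
  then show ?thesis
    unfolding escape_def F_eq
    using tendsto_diff[OF tendsto_const summable_LIMSEQ[OF summable_first_returns]] by simp
qed

lemma F_le_1: "F \<le> 1"
proof -
  have "0 \<le> 1 - F"
    by (rule LIMSEQ_le_const[OF escape_tendsto]) (use escape_bounds in auto)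
  then show ?thesis by simp
qed

text \<open>
  If the period is \<open>1\<close>, then some loop of odd length \<open>k\<close> has positive probability, and starting with it
  turns a bridge of even length \<open>n - k\<close> into one of odd length \<open>n\<close>, so that \<open>c = returns k\<close> works.
  Otherwise only even \<open>n\<close> matter.
\<close>

lemma returns_ge_even:
  "\<exists>c>0. \<forall>\<^sub>F n in multiples_at_top (walk_period G M X). c * w (n div 2) \<le> returns n"
proof (cases "\<exists>k. odd k \<and> 0 < returns k")
  case True
  then obtain k where k: "odd k" "0 < returns k" by auto
  have "returns k * w (n div 2) \<le> returns n" if "k \<le> n" for n
  proof (cases "even n")
    case True
    have "returns k * w (n div 2) \<le> 1 * w (n div 2)"
      using u_le_1 w_pos by (intro mult_right_mono) (auto intro: less_imp_le)
    then show ?thesis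
      using True by (simp add: w_def)
  next
    case False
    then have even: "even (n - k)"
      using k that by simp
    have "returns k * w (n div 2) \<le> returns k * w ((n - k) div 2)"
      using k by (intro mult_left_mono w_antimono div_le_mono) auto
    also have "\<dots> = returns k * returns (n - k)"
      using even by (simp add: w_def)
    also have "\<dots> \<le> returns n"
      using returns_supermultiplicative[of k "n - k"] that by simp
    finally show ?thesis .
  qed
  then have "\<forall>\<^sub>F n in sequentially. returns k * w (n div 2) \<le> returns n"
    by (intro eventually_sequentiallyI)
  then have "\<forall>\<^sub>F n in multiples_at_top (walk_period G M X). returns k * w (n div 2) \<le> returns n"
    unfolding multiples_at_top_def by (rule filter_leD[OF inf_le1])
  with k show ?thesis by blast
next
  case False
  have "2 dvd walk_period G M X"
    unfolding walk_period_def
  proof (rule Gcd_greatest)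
    fix n assume "n \<in> {n. 1 \<le> n \<and> 0 < return_prob G M X n}"
    then have "0 < returns n" by (simp add: return_prob_eq_returns)
    with False show "2 dvd n" by blast
  qed
  then have "1 * w (n div 2) \<le> returns n" if "walk_period G M X dvd n" for n
    using dvd_trans[OF _ that] by (auto simp: w_def)
  then have "\<forall>\<^sub>F n in multiples_at_top (walk_period G M X). 1 * w (n div 2) \<le> returns n"
    unfolding multiples_at_top_def eventually_inf_principal by (intro always_eventually) simp
  then show ?thesis by (metis zero_less_one)
qed

lemma exponential_over_return_tendsto_0:
  assumes slope: "(\<lambda>a. ln (w a) / real a) \<longlonglongrightarrow> 0" and "0 < \<kappa>"
  shows "(\<lambda>n. exp (- \<kappa> * real n) / w (n div 2)) \<longlonglongrightarrow> 0"
proof (rule tendsto_sandwich)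
  show "\<forall>\<^sub>F n in sequentially. 0 \<le> exp (- \<kappa> * real n) / w (n div 2)"
    using w_pos by (intro always_eventually allI divide_nonneg_pos) auto
  obtain K where K: "\<And>a. K \<le> a \<Longrightarrow> - \<kappa> < ln (w a) / real a"
    using order_tendstoD(1)[OF slope, of "- \<kappa>"] \<open>0 < \<kappa>\<close> by (auto simp: eventually_sequentially)
  have "exp (- \<kappa> * real n) / w (n div 2) \<le> exp (- \<kappa> / 2 * real n)" if n: "2 * K + 2 \<le> n" for n
  proof -
    let ?a = "n div 2"
    have a: "K \<le> ?a" "0 < ?a" "real ?a \<le> real n / 2"
      using n by linarith+
    have "- \<kappa> / 2 * real n \<le> - \<kappa> * real ?a"
      using a \<open>0 < \<kappa>\<close> by simp
    also have "\<dots> \<le> ln (w ?a)"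
      using K[OF a(1)] a(2) by (simp add: field_simps)
    finally have "exp (- \<kappa> / 2 * real n) \<le> w ?a"
      using w_pos by (simp add: ln_ge_iff)
    then have "exp (- \<kappa> * real n) / w ?a \<le> exp (- \<kappa> * real n) / exp (- \<kappa> / 2 * real n)"
      by (intro divide_left_mono) (auto simp: w_pos)
    also have "\<dots> = exp (- \<kappa> / 2 * real n)"
      by (simp flip: exp_diff)
    finally show ?thesis .
  qed
  then show "\<forall>\<^sub>F n in sequentially. exp (- \<kappa> * real n) / w (n div 2) \<le> exp (- \<kappa> / 2 * real n)"
    by (rule eventually_sequentiallyI)
  show "(\<lambda>n. exp (- \<kappa> / 2 * real n)) \<longlonglongrightarrow> 0"
    using \<open>0 < \<kappa>\<close> by real_asymp
qed simp

text \<open>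
  The deviation probability of order \<open>exp (- \<kappa> * n)\<close> is compared with \<open>w (n div 2)\<close>, to which \<open>returns n\<close>
  is comparable, in preparation for conditioning on the bridge.
\<close>

lemma fresh_deviation_negligible:
  assumes slope: "(\<lambda>a. ln (w a) / real a) \<longlonglongrightarrow> 0" and "0 < \<epsilon>" "1 \<le> N" "0 < \<delta>"
  shows "\<forall>\<^sub>F n in sequentially.
    prob {\<omega>\<in>space M. \<bar>(\<Sum>k<n. fresh_at N k \<omega>) - real n * escape N\<bar> \<ge> \<epsilon> * real n} \<le> \<delta> * w (n div 2)"
proof -
  define \<kappa> where "\<kappa> = \<epsilon>\<^sup>2 / (2 * real N)"
  define K where "K = 2 * real N * exp (\<epsilon>\<^sup>2 / 2)"
  have \<kappa>: "0 < \<kappa>" and K: "0 < K"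
    using assms by (simp_all add: \<kappa>_def K_def)
  have "\<forall>\<^sub>F n in sequentially. exp (- \<kappa> * real n) / w (n div 2) < \<delta> / K"
    using exponential_over_return_tendsto_0[OF slope \<kappa>] assms(4) K by (intro order_tendstoD(2)) auto
  moreover have "\<forall>\<^sub>F n::nat in sequentially. real N \<le> \<epsilon> / 2 * real n"
    using \<open>0 < \<epsilon>\<close> by real_asymp
  ultimately show ?thesis
    using eventually_ge_at_top[of N]
  proof eventually_elim
    case (elim n)
    have "real n < real N * (real (n div N) + 1)"
      using assms(3) dividend_less_times_div[of N n]
      by (metis Suc_eq_plus1 Suc_le_eq add.commute mult_Suc_right of_nat_Suc of_nat_less_iff of_nat_mult One_nat_def)
    then have "real n / real N - 1 \<le> real (n div N)"
      using assms(3) by (simp add: field_simps)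
    then have "\<epsilon>\<^sup>2 / 2 * (real n / real N - 1) \<le> \<epsilon>\<^sup>2 / 2 * real (n div N)"
      by (intro mult_left_mono) auto
    then have "- \<epsilon>\<^sup>2 / 2 * real (n div N) \<le> \<epsilon>\<^sup>2 / 2 + - \<kappa> * real n"
      using assms(3) by (simp add: \<kappa>_def field_simps)
    then have "exp (- \<epsilon>\<^sup>2 / 2 * real (n div N)) \<le> exp (\<epsilon>\<^sup>2 / 2) * exp (- \<kappa> * real n)"
      by (simp flip: exp_add)
    then have "2 * real N * exp (- \<epsilon>\<^sup>2 / 2 * real (n div N)) \<le> K * exp (- \<kappa> * real n)"
      using assms(3) by (simp add: K_def mult.assoc)
    also have "\<dots> \<le> \<delta> * w (n div 2)"
      using elim(1) K w_pos[of "n div 2"] by (simp add: field_simps)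
    finally show ?case
      using fresh_concentration[of \<epsilon> N n] assms elim by linarith
  qed
qed

text \<open>
  For \<open>F = 1\<close> only the upper bound on the range has content, and long loops do not affect it. For \<open>F < 1\<close>
  the return probabilities are summable, and long loops are rare. The tolerance \<open>\<epsilon>\<close> is shared by the deviation
  of \<open>escape N\<close> from its limit, that of the fresh times from their mean, and the term \<open>N\<close> or the number of
  long loops.
\<close>

lemma bridge_range_concentration:
  assumes slope: "(\<lambda>a. ln (w a) / real a) \<longlonglongrightarrow> 0" and bound: "short_loop_bound m C" and "0 < \<epsilon>"
  shows "((\<lambda>n. \<P>(\<omega> in M. \<bar>1 / real n * real (walk_range G X n \<omega>) - 1 + F\<bar> > \<epsilon> \<bar> walk G X n \<omega> = \<one>))
    \<longlongrightarrow> 0) (multiples_at_top (walk_period G M X))"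
proof (rule tendstoI)
  fix \<delta> :: real assume "0 < \<delta>"
  let ?\<Phi> = "multiples_at_top (walk_period G M X)"
  obtain c where c: "0 < c" "\<forall>\<^sub>F n in ?\<Phi>. c * w (n div 2) \<le> returns n"
    using returns_ge_even by blast
  define \<epsilon>' where "\<epsilon>' = \<epsilon> / 4"
  define \<eta> where "\<eta> = \<delta> * c / 4"
  have pos: "0 < \<epsilon>'" "0 < \<eta>"
    using \<open>0 < \<epsilon>\<close> \<open>0 < \<delta>\<close> c by (simp_all add: \<epsilon>'_def \<eta>_def)
  obtain N1 where N1: "\<And>N. N1 \<le> N \<Longrightarrow> \<bar>escape N - (1 - F)\<bar> < \<epsilon>'"
    using LIMSEQ_D[OF escape_tendsto pos(1)] by auto
  have "\<exists>N0. \<forall>N\<ge>N0. \<forall>\<^sub>F n in sequentially. F < 1 \<longrightarrow>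
      prob {\<omega>\<in>space M. loop_count N n \<omega> \<ge> \<epsilon>' * real n} \<le> \<eta> * w (n div 2)"
  proof (cases "F < 1")
    case True
    then have "summable returns"
      by (intro transient_imp_summable_returns) (simp add: F_eq)
    then obtain N0 where N0: "\<And>N. N0 \<le> N \<Longrightarrow> \<forall>\<^sub>F n in sequentially.
        (\<Sum>j\<in>{N<..<n}. real (n - j) * (returns j * returns (n - j))) \<le> \<epsilon>' * \<eta> * real n * w (n div 2)"
      using long_loops_negligible[OF _ bound, of "\<epsilon>' * \<eta>"] pos by auto
    show ?thesis
    proof (intro exI[of _ N0] allI impI)
      fix N assume "N0 \<le> N"
      show "\<forall>\<^sub>F n in sequentially. F < 1 \<longrightarrow>
          prob {\<omega>\<in>space M. loop_count N n \<omega> \<ge> \<epsilon>' * real n} \<le> \<eta> * w (n div 2)"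
        using N0[OF \<open>N0 \<le> N\<close>] eventually_gt_at_top[of 0]
      proof eventually_elim
        case (elim n)
        then have *: "0 < \<epsilon>' * real n"
          using pos by simp
        have "prob {\<omega>\<in>space M. loop_count N n \<omega> \<ge> \<epsilon>' * real n}
            \<le> (\<Sum>j\<in>{N<..<n}. real (n - j) * (returns j * returns (n - j))) / (\<epsilon>' * real n)"
          by (rule prob_many_long_loops[OF *])
        also have "\<dots> \<le> \<epsilon>' * \<eta> * real n * w (n div 2) / (\<epsilon>' * real n)"
          using elim * by (intro divide_right_mono) auto
        also have "\<dots> = \<eta> * w (n div 2)"
          using pos elim by simp
        finally show ?case by simp
      qed
    qed
  qed auto
  then obtain N0 where N0: "\<And>N. N0 \<le> N \<Longrightarrow> \<forall>\<^sub>F n in sequentially. F < 1 \<longrightarrow>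
      prob {\<omega>\<in>space M. loop_count N n \<omega> \<ge> \<epsilon>' * real n} \<le> \<eta> * w (n div 2)"
    by blast
  define N where "N = N0 + N1 + 1"
  have N: "N0 \<le> N" "N1 \<le> N" "1 \<le> N"
    by (simp_all add: N_def)
  have large: "\<forall>\<^sub>F n::nat in sequentially. real N \<le> \<epsilon>' * real n"
    using pos by real_asymp
  have "\<forall>\<^sub>F n in sequentially. 0 < n \<and> real N \<le> \<epsilon>' * real n \<and>
      (F < 1 \<longrightarrow> prob {\<omega>\<in>space M. loop_count N n \<omega> \<ge> \<epsilon>' * real n} \<le> \<eta> * w (n div 2)) \<and>
      prob {\<omega>\<in>space M. \<bar>(\<Sum>k<n. fresh_at N k \<omega>) - real n * escape N\<bar> \<ge> \<epsilon>' * real n} \<le> \<eta> * w (n div 2)"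
    by (intro eventually_conj eventually_gt_at_top large N0[OF N(1)]
        fresh_deviation_negligible[OF slope pos(1) N(3) pos(2)])
  then have "\<forall>\<^sub>F n in ?\<Phi>. 0 < n \<and> real N \<le> \<epsilon>' * real n \<and>
      (F < 1 \<longrightarrow> prob {\<omega>\<in>space M. loop_count N n \<omega> \<ge> \<epsilon>' * real n} \<le> \<eta> * w (n div 2)) \<and>
      prob {\<omega>\<in>space M. \<bar>(\<Sum>k<n. fresh_at N k \<omega>) - real n * escape N\<bar> \<ge> \<epsilon>' * real n} \<le> \<eta> * w (n div 2)"
    unfolding multiples_at_top_def by (rule filter_leD[OF inf_le1])
  with c(2) show "\<forall>\<^sub>F n in ?\<Phi>. dist (\<P>(\<omega> in M.
      \<bar>1 / real n * real (walk_range G X n \<omega>) - 1 + F\<bar> > \<epsilon> \<bar> walk G X n \<omega> = \<one>)) 0 < \<delta>"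
  proof eventually_elim
    case (elim n)
    let ?bad = "{\<omega>\<in>space M. \<bar>1 / real n * real (walk_range G X n \<omega>) - 1 + F\<bar> > \<epsilon> \<and> walk G X n \<omega> = \<one>}"
    let ?dev = "{\<omega>\<in>space M. \<bar>(\<Sum>k<n. fresh_at N k \<omega>) - real n * escape N\<bar> \<ge> \<epsilon>' * real n}"
    let ?loops = "{\<omega>\<in>space M. loop_count N n \<omega> \<ge> \<epsilon>' * real n}"
    have n: "0 < real n" "real N \<le> \<epsilon>' * real n"
      using elim by simp_all
    have events: "?dev \<in> events" "?loops \<in> events"
      using fresh_at_measurable_sum[where f = "\<lambda>k. k" and A = "{..<n}"] loop_count_measurable
      by measurable
    have esc: "\<bar>real n * escape N - real n * (1 - F)\<bar> \<le> \<epsilon>' * real n"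
    proof -
      have "\<bar>real n * escape N - real n * (1 - F)\<bar> = real n * \<bar>escape N - (1 - F)\<bar>"
        by (simp add: abs_mult flip: right_diff_distrib)
      also have "\<dots> \<le> real n * \<epsilon>'"
        using N1[OF N(2)] by (intro mult_left_mono) auto
      finally show ?thesis by (simp add: mult.commute)
    qed
    \<comment> \<open>On the complement of the exceptional events both bounds on the range hold up to \<open>3 * \<epsilon>' * n\<close>.\<close>
    have dichotomy: "\<omega> \<in> ?dev \<or> F < 1 \<and> \<omega> \<in> ?loops" if \<omega>: "\<omega> \<in> ?bad" for \<omega>
    proof (rule ccontr)
      assume not: "\<not> (\<omega> \<in> ?dev \<or> F < 1 \<and> \<omega> \<in> ?loops)"
      have space: "\<omega> \<in> space M" "trajectory \<omega> n = \<one>"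
        using \<omega> by simp_all
      define R where "R = real (walk_range G X n \<omega>)"
      define V where "V = (\<Sum>k<n. fresh_at N k \<omega>)"
      have V: "\<bar>V - real n * escape N\<bar> < \<epsilon>' * real n"
        using not space by (simp add: V_def not_le)
      have "R \<le> V + real N"
        using card_range_le_fresh[of "trajectory \<omega>" n N]
        unfolding R_def V_def walk_range_def card_fresh_eq_sum[OF space(1), symmetric] by linarith
      then have upper: "R - real n * (1 - F) \<le> 3 * \<epsilon>' * real n"
        using V esc n by linarith
      have lower: "- (3 * \<epsilon>' * real n) \<le> R - real n * (1 - F)"
      proof (cases "F < 1")
        case True
        then have "loop_count N n \<omega> < \<epsilon>' * real n"
          using not space by (simp add: not_le)
        moreover have "V \<le> R + loop_count N n \<omega>"
          using fresh_le_card_range[of n N "trajectory \<omega>"]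
          unfolding R_def V_def walk_range_def card_fresh_eq_sum[OF space(1), symmetric]
            card_long_loops_bridge[OF space, symmetric] by linarith
        ultimately show ?thesis
          using V esc by linarith
      next
        case False
        then have "F = 1"
          using F_le_1 by simp
        then show ?thesis
          using pos n by (simp add: R_def add_nonneg_nonneg mult_nonneg_nonneg order_trans[of _ 0])
      qed
      have "1 / real n * R - 1 + F = (R - real n * (1 - F)) / real n"
        using n by (simp add: field_simps)
      also have "\<bar>\<dots>\<bar> \<le> 3 * \<epsilon>'"
        using upper lower n by (simp add: abs_le_iff divide_le_eq le_divide_eq)
      also have "\<dots> \<le> \<epsilon>"
        using \<open>0 < \<epsilon>\<close> by (simp add: \<epsilon>'_def)
      finally show False
        using \<omega> by (simp add: R_def)
    qed
    have "prob ?bad \<le> 2 * \<eta> * w (n div 2)"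
    proof (cases "F < 1")
      case True
      have "prob ?bad \<le> prob (?dev \<union> ?loops)"
        using dichotomy events by (intro finite_measure_mono) blast+
      also have "\<dots> \<le> prob ?dev + prob ?loops"
        using events by (rule measure_Un_le)
      finally show ?thesis
        using elim True by linarith
    next
      case False
      have "prob ?bad \<le> prob ?dev"
        using dichotomy events False by (intro finite_measure_mono) blast+
      also have "\<dots> \<le> \<eta> * w (n div 2)"
        using elim by simp
      also have "\<dots> \<le> 2 * \<eta> * w (n div 2)"
        using pos w_pos[of "n div 2"] by simp
      finally show ?thesis .
    qed
    moreover have return: "\<P>(\<omega> in M. walk G X n \<omega> = \<one>) = returns n"
      using return_prob_eq_returns by (simp add: return_prob_def)
    have "0 < c * w (n div 2)"
      using c w_pos by simp
    ultimately have "prob ?bad / returns n \<le> 2 * \<eta> * w (n div 2) / (c * w (n div 2))"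
      using elim pos w_pos[of "n div 2"] by (intro frac_le) auto
    also have "\<dots> = \<delta> / 2"
      using c w_nonzero by (simp add: \<eta>_def)
    also have "\<dots> < \<delta>"
      using \<open>0 < \<delta>\<close> by simp
    finally show ?case
      unfolding cond_prob_def return using measure_nonneg[of M ?bad] u_nonneg[of n]
      by (simp add: dist_real_def)
  qed
qed

end

theorem theorem2:
  fixes G :: "('a, 'b) monoid_scheme" and M :: "'w measure"
    and s :: nat and gen :: "nat \<Rightarrow> 'a" and \<alpha> :: "nat \<Rightarrow> real" and X :: "nat \<Rightarrow> 'w \<Rightarrow> 'a"
  assumes walk: "cayley_random_walk G M s gen \<alpha> X"
    and infinite: "infinite (carrier G)"
    and symmetric: "\<And>i. i \<in> {1..s} \<Longrightarrow> \<alpha> i = \<alpha> (s + i)"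
    and positive: "\<And>i. i \<in> {1..2 * s} \<Longrightarrow> 0 < \<alpha> i"
    and AB: "limsup (\<lambda>n. ereal (return_prob G M X (2 * n) / return_prob G M X (4 * n))) < \<infinity>
      \<or> (\<exists>(g :: nat \<Rightarrow> real) (h :: nat \<Rightarrow> real).
            (\<forall>n. 0 \<le> g n) \<and> (\<forall>n. 0 \<le> h n)
          \<and> mono g \<and> filterlim g at_top sequentially
          \<and> (\<lambda>n. 1 / real n * g n) \<longlonglongrightarrow> 0
          \<and> ((\<lambda>n. real n * h (nat \<lfloor>real n / g (n div 2)\<rfloor>)) \<longlongrightarrow> 0) (multiples_at_top 2)
          \<and> (\<forall>\<^sub>F n in sequentially.
                exp (- g n) \<le> return_prob G M X (2 * n) \<and> return_prob G M X (2 * n) \<le> h n))"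
  shows "\<forall>\<epsilon>>0. ((\<lambda>n. \<P>(\<omega> in M.
            \<bar>1 / real n * real (walk_range G X n \<omega>) - 1 + ever_return_prob G M X\<bar> > \<epsilon>
              \<bar> walk G X n \<omega> = \<one>\<^bsub>G\<^esub>)) \<longlongrightarrow> 0)
          (multiples_at_top (walk_period G M X))"
proof -
  interpret symmetric_cayley_walk G M s gen \<alpha> X
    by (rule symmetric_cayley_walk.intro[OF walk]) (unfold_locales, rule symmetric)
  have "\<exists>m C. (\<lambda>a. ln (w a) / real a) \<longlonglongrightarrow> 0 \<and> short_loop_bound m C"
    using AB
  proof
    assume "limsup (\<lambda>n. ereal (return_prob G M X (2 * n) / return_prob G M X (4 * n))) < \<infinity>"
    then obtain C where "limsup (\<lambda>n. ereal (return_prob G M X (2 * n) / return_prob G M X (4 * n))) < ereal C"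
      using ereal_dense2 by blast
    then have "\<forall>\<^sub>F n in sequentially. ereal (return_prob G M X (2 * n) / return_prob G M X (4 * n)) < ereal C"
      by (rule Limsup_lessD)
    then have "\<forall>\<^sub>F n in sequentially. w n \<le> C * w (2 * n)"
    proof eventually_elim
      case (elim n)
      then have "w n / w (2 * n) < C"
        by (simp add: return_prob_eq_returns w_def)
      then show ?case
        using w_pos[of "2 * n"] by (simp add: divide_less_eq)
    qed
    from doubling_imp_short_loop_bound[OF this] show ?thesis by blast
  next
    assume "\<exists>(g :: nat \<Rightarrow> real) (h :: nat \<Rightarrow> real).
            (\<forall>n. 0 \<le> g n) \<and> (\<forall>n. 0 \<le> h n)
          \<and> mono g \<and> filterlim g at_top sequentially
          \<and> (\<lambda>n. 1 / real n * g n) \<longlonglongrightarrow> 0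
          \<and> ((\<lambda>n. real n * h (nat \<lfloor>real n / g (n div 2)\<rfloor>)) \<longlongrightarrow> 0) (multiples_at_top 2)
          \<and> (\<forall>\<^sub>F n in sequentially.
                exp (- g n) \<le> return_prob G M X (2 * n) \<and> return_prob G M X (2 * n) \<le> h n)"
    then obtain g h :: "nat \<Rightarrow> real" where gh: "filterlim g at_top sequentially"
      "(\<lambda>n. 1 / real n * g n) \<longlonglongrightarrow> 0"
      "((\<lambda>n. real n * h (nat \<lfloor>real n / g (n div 2)\<rfloor>)) \<longlongrightarrow> 0) (multiples_at_top 2)"
      "\<forall>\<^sub>F n in sequentially. exp (- g n) \<le> w n \<and> w n \<le> h n"
      unfolding return_prob_eq_returns w_def by blast
    from sandwich_imp_short_loop_bound[OF this] show ?thesis by blast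
  qed
  then show ?thesis
    using bridge_range_concentration by blast
qed

end
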